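(* Let $F$ be a 4-regular graph with a circuit partition $P$, and let $C$ be an Euler system of $F$ that is compatible with $P$. Then the dual $M_A(\mathcal{I}_P(C))^{*}$ of the adjacency matroid of the relative interlacement graph $\mathcal{I}_P(C)$ is the polygon matroid of the touch-graph $Tch(P)$ (where the edges of $Tch(P)$ are identified with the vertices of $F$, and $V(\mathcal{I}_P(C))=V(F)$).
   Context: Graphs are finite and may have loops and parallel edges. In a 4-regular graph every vertex has exactly four incident half-edges (a loop contributes two). Adjacency matroid: for a graph $G$, $\mathcal{A}(G)$ is the symmetric $V(G)\times V(G)$ matrix over $GF(2)$ with $a_{vv}=1$ iff $v$ is looped and, for $v\ne w$, $a_{vw}=1$ iff $v,w$ are adjacent; $M_A(G)$ is the binary matroid on $V(G)$ whose circuits are the minimal nonempty $S\subseteq V(G)$ such that the columns of $\mathcal{A}(G)$ indexed by $S$ are linearly dependent. The polygon matroid of a graph is the matroid on its edge set whose circuits are the minimal edge-sets of closed trails. $M^*$ denotes the dual matroid. A circuit (closed trail) is a closed walk with no repeated edge (vertices may repeat). A circuit partition $P$ of a 4-regular graph $F$ is a partition of $E(F)$ into edge-sets of closed trails; the closed trails themselves are part of the data, so that at each vertex $P$ determines a transition, i.e. a pairing of the four half-edges at the vertex into two pairs (consecutive half-edges along the circuits), and $P$ is determined by its transitions. An Euler system $C$ of $F$ is a circuit partition consisting of exactly one Euler circuit of each connected component of $F$. $C$ and $P$ are compatible if their transitions differ at every vertex of $F$. The touch-graph $Tch(P)$ has a vertex for each element (circuit) of $P$ and an edge for each vertex of $F$;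 the edge corresponding to $v\in V(F)$ is incident on the vertex or vertices corresponding to the element(s) of $P$ incident at $v$ (it is a loop if only one circuit of $P$ is incident at $v$). The interlacement graph $\mathcal{I}(C)$ is the simple graph with vertex set $V(F)$ in which $v\neq w$ are adjacent iff there is some circuit of $C$ on which they appear in the order $v\dots w\dots v\dots w$. Orient each circuit of $C$ arbitrarily and direct the edges of $F$ accordingly, so that each vertex $v$ has two in-directed and two out-directed half-edges. The transition of $P$ at $v$ is of type $\phi$ if it pairs each in-directed half-edge with the out-directed half-edge that follows it on $C$ (i.e. it agrees with $C$); of type $\chi$ if it pairs each in-directed half-edge with the out-directed half-edge that does not follow it on $C$; and of type $\psi$ if it pairs the two in-directed half-edges with each other (and the two out-directed ones with each other). These types do not depend on the choice of orientations. The relative interlacement graph $\mathcal{I}_P(C)$ is obtained from $\mathcal{I}(C)$ by removing each vertex of type $\phi$ and attaching a loop at each vertex of type $\psi$; when $C$ and $P$ are compatible no vertex is removed. *)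

theory Defs
  imports Main "HOL-Library.Z2" "HOL-Library.Disjoint_Sets"
begin

record ('v, 'e) graph =
  verts :: "'v set"
  edges :: "'e set"
  ends :: "'e \<Rightarrow> 'v set"

text \<open>An edge has two end-vertices, or a single one if it is a loop.\<close>

definition finite_graph :: "('v, 'e) graph \<Rightarrow> bool" where
  "finite_graph G \<longleftrightarrow> finite (verts G) \<and> finite (edges G) \<and>
     (\<forall>e\<in>edges G. ends G e \<subseteq> verts G \<and> card (ends G e) \<in> {1, 2})"

definition adjacent :: "('v, 'e) graph \<Rightarrow> 'v \<Rightarrow> 'v \<Rightarrow> bool" where
  "adjacent G v w \<longleftrightarrow> (\<exists>e\<in>edges G. ends G e = {v, w})"

definition components :: "('v, 'e) graph \<Rightarrow> 'v set set" where
  "components G =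
     verts G // {(v, w). v \<in> verts G \<and> w \<in> verts G \<and> (adjacent G)\<^sup>*\<^sup>* v w}"

definition edges_within :: "('v, 'e) graph \<Rightarrow> 'v set \<Rightarrow> 'e set" where
  "edges_within G K = {e \<in> edges G. ends G e \<subseteq> K}"

text \<open>
  A half-edge is a triple of an edge, an end-vertex of it and an index; the index only serves to
  distinguish the two half-edges of a loop.
\<close>

type_synonym ('v, 'e) half_edge = "'e \<times> 'v \<times> nat"

definition he_edge :: "('v, 'e) half_edge \<Rightarrow> 'e" where
  "he_edge h = fst h"

definition he_vertex :: "('v, 'e) half_edge \<Rightarrow> 'v" where
  "he_vertex h = fst (snd h)"

definition half_edges :: "('v, 'e) graph \<Rightarrow> ('v, 'e) half_edge set" where
  "half_edges G =
     {(e, v, i). e \<in> edges G \<and> v \<in> ends G e \<and> i < (if ends G e = {v} then 2 else 1)}"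

definition half_edges_at :: "('v, 'e) graph \<Rightarrow> 'v \<Rightarrow> ('v, 'e) half_edge set" where
  "half_edges_at G v = {h \<in> half_edges G. he_vertex h = v}"

definition opposite :: "('v, 'e) graph \<Rightarrow> ('v, 'e) half_edge \<Rightarrow> ('v, 'e) half_edge" where
  "opposite G h = (THE h'. h' \<in> half_edges G \<and> he_edge h' = he_edge h \<and> h' \<noteq> h)"

definition four_regular :: "('v, 'e) graph \<Rightarrow> bool" where
  "four_regular G \<longleftrightarrow> finite_graph G \<and> (\<forall>v\<in>verts G. card (half_edges_at G v) = 4)"

text \<open>
  A closed trail is given by the cyclic list of half-edges by which it leaves its successive
  vertices: it leaves along \<open>h\<close>, arrives by \<open>opposite G h\<close>, and continues with the next entry.
\<close>

definition closed_trail :: "('v, 'e) graph \<Rightarrow> ('v, 'e) half_edge list \<Rightarrow> bool" where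
  "closed_trail G hs \<longleftrightarrow>
     hs \<noteq> [] \<and> set hs \<subseteq> half_edges G \<and> distinct (map he_edge hs) \<and>
     (\<forall>i<length hs.
        he_vertex (opposite G (hs ! i)) = he_vertex (hs ! (Suc i mod length hs)))"

definition trail_transitions ::
    "('v, 'e) graph \<Rightarrow> ('v, 'e) half_edge list \<Rightarrow> ('v, 'e) half_edge set set" where
  "trail_transitions G hs =
     {{opposite G (hs ! i), hs ! (Suc i mod length hs)} | i. i < length hs}"

text \<open>
  A circuit is a closed trail up to the choice of starting point and direction of traversal,
  that is, an equivalence class of lists.
\<close>

type_synonym ('v, 'e) circuit = "('v, 'e) half_edge list set"

definition circuit_of ::
    "('v, 'e) graph \<Rightarrow> ('v, 'e) half_edge list \<Rightarrow> ('v, 'e) circuit" where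
  "circuit_of G hs =
     {hs'. \<exists>n. hs' = rotate n hs \<or> hs' = rotate n (map (opposite G) (rev hs))}"

definition graph_circuits :: "('v, 'e) graph \<Rightarrow> ('v, 'e) circuit set" where
  "graph_circuits G = {circuit_of G hs | hs. closed_trail G hs}"

definition circuit_edges :: "('v, 'e) circuit \<Rightarrow> 'e set" where
  "circuit_edges c = (\<Union>hs\<in>c. he_edge ` set hs)"

definition circuit_vertices :: "('v, 'e) circuit \<Rightarrow> 'v set" where
  "circuit_vertices c = (\<Union>hs\<in>c. he_vertex ` set hs)"

definition circuit_transitions ::
    "('v, 'e) graph \<Rightarrow> ('v, 'e) circuit \<Rightarrow> ('v, 'e) half_edge set set" where
  "circuit_transitions G c = (\<Union>hs\<in>c. trail_transitions G hs)"

definition circuit_partition :: "('v, 'e) graph \<Rightarrow> ('v, 'e) circuit set \<Rightarrow> bool" where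
  "circuit_partition F P \<longleftrightarrow>
     P \<subseteq> graph_circuits F \<and> disjoint_family_on circuit_edges P \<and>
     (\<Union>c\<in>P. circuit_edges c) = edges F"

text \<open>The pairing of the half-edges at \<open>v\<close> determined by \<open>P\<close>, as a set of pairs.\<close>

definition transition ::
    "('v, 'e) graph \<Rightarrow> ('v, 'e) circuit set \<Rightarrow> 'v \<Rightarrow> ('v, 'e) half_edge set set" where
  "transition F P v = {t \<in> (\<Union>c\<in>P. circuit_transitions F c). t \<subseteq> half_edges_at F v}"

definition euler_circuit :: "('v, 'e) graph \<Rightarrow> 'v set \<Rightarrow> ('v, 'e) circuit \<Rightarrow> bool" where
  "euler_circuit F K c \<longleftrightarrow> c \<in> graph_circuits F \<and> circuit_edges c = edges_within F K"

definition euler_system :: "('v, 'e) graph \<Rightarrow> ('v, 'e) circuit set \<Rightarrow> bool" where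
  "euler_system F C \<longleftrightarrow>
     circuit_partition F C \<and>
     (\<forall>c\<in>C. \<exists>K\<in>components F. euler_circuit F K c) \<and>
     (\<forall>K\<in>components F. \<exists>!c. c \<in> C \<and> euler_circuit F K c)"

definition compatible ::
    "('v, 'e) graph \<Rightarrow> ('v, 'e) circuit set \<Rightarrow> ('v, 'e) circuit set \<Rightarrow> bool" where
  "compatible F C P \<longleftrightarrow> (\<forall>v\<in>verts F. transition F C v \<noteq> transition F P v)"

definition touch_graph ::
    "('v, 'e) graph \<Rightarrow> ('v, 'e) circuit set \<Rightarrow> (('v, 'e) circuit, 'v) graph" where
  "touch_graph F P =
     \<lparr>verts = P, edges = verts F, ends = (\<lambda>v. {c \<in> P. v \<in> circuit_vertices c})\<rparr>"

definition interlaced :: "('v, 'e) circuit set \<Rightarrow> 'v \<Rightarrow> 'v \<Rightarrow> bool" where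
  "interlaced C v w \<longleftrightarrow>
     v \<noteq> w \<and>
     (\<exists>c\<in>C. \<exists>hs\<in>c. \<exists>i j k l. i < j \<and> j < k \<and> k < l \<and> l < length hs \<and>
        he_vertex (hs ! i) = v \<and> he_vertex (hs ! j) = w \<and>
        he_vertex (hs ! k) = v \<and> he_vertex (hs ! l) = w)"

text \<open>In the graphs below, an edge is the set of its end-vertices.\<close>

definition interlacement_graph ::
    "('v, 'e) graph \<Rightarrow> ('v, 'e) circuit set \<Rightarrow> ('v, 'v set) graph" where
  "interlacement_graph F C =
     \<lparr>verts = verts F,
      edges = {{v, w} | v w. v \<in> verts F \<and> w \<in> verts F \<and> interlaced C v w},
      ends = (\<lambda>e. e)\<rparr>"

text \<open>
  Choosing a representative of every circuit in \<open>C\<close> orients the circuits. The set \<open>D\<close> consists of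
  the out-directed half-edges, so the in-directed half-edges at \<open>v\<close> are those not in \<open>D\<close>.
\<close>

definition orientation ::
    "('v, 'e) circuit set \<Rightarrow> ('v, 'e) half_edge set \<Rightarrow> bool" where
  "orientation C D \<longleftrightarrow> (\<exists>r. (\<forall>c\<in>C. r c \<in> c) \<and> D = (\<Union>c\<in>C. set (r c)))"

definition type_phi ::
    "('v, 'e) graph \<Rightarrow> ('v, 'e) circuit set \<Rightarrow> ('v, 'e) circuit set \<Rightarrow> 'v \<Rightarrow> bool" where
  "type_phi F C P v \<longleftrightarrow> transition F P v = transition F C v"

text \<open>The type does not depend on the orientation, so any orientation may serve as witness.\<close>

definition type_psi ::
    "('v, 'e) graph \<Rightarrow> ('v, 'e) circuit set \<Rightarrow> ('v, 'e) circuit set \<Rightarrow> 'v \<Rightarrow> bool" where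
  "type_psi F C P v \<longleftrightarrow>
     (\<exists>D. orientation C D \<and>
        transition F P v = {half_edges_at F v - D, half_edges_at F v \<inter> D})"

definition relative_interlacement_graph ::
    "('v, 'e) graph \<Rightarrow> ('v, 'e) circuit set \<Rightarrow> ('v, 'e) circuit set \<Rightarrow> ('v, 'v set) graph" where
  "relative_interlacement_graph F C P =
     (let V = {v \<in> verts (interlacement_graph F C). \<not> type_phi F C P v} in
      \<lparr>verts = V,
       edges = edges_within (interlacement_graph F C) V \<union> {{v} | v. v \<in> V \<and> type_psi F C P v},
       ends = (\<lambda>e. e)\<rparr>)"

text \<open>The record carries no axioms; two matroids are equal iff their ground sets and circuits agree.\<close>

record 'a matroid =
  ground :: "'a set"
  circuits :: "'a set set"

definition minimal_sets :: "'a set set \<Rightarrow> 'a set set" where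
  "minimal_sets \<S> = {S \<in> \<S>. \<forall>T\<in>\<S>. T \<subseteq> S \<longrightarrow> T = S}"

definition indep :: "'a matroid \<Rightarrow> 'a set \<Rightarrow> bool" where
  "indep M I \<longleftrightarrow> I \<subseteq> ground M \<and> (\<forall>S\<in>circuits M. \<not> S \<subseteq> I)"

definition bases :: "'a matroid \<Rightarrow> 'a set set" where
  "bases M = {B. indep M B \<and> (\<forall>I. indep M I \<longrightarrow> B \<subseteq> I \<longrightarrow> I = B)}"

definition matroid_of_bases :: "'a set \<Rightarrow> 'a set set \<Rightarrow> 'a matroid" where
  "matroid_of_bases E \<B> =
     \<lparr>ground = E, circuits = minimal_sets {S. S \<subseteq> E \<and> \<not> (\<exists>B\<in>\<B>. S \<subseteq> B)}\<rparr>"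

definition dual :: "'a matroid \<Rightarrow> 'a matroid" where
  "dual M = matroid_of_bases (ground M) ((\<lambda>B. ground M - B) ` bases M)"

text \<open>On the diagonal, \<open>adjacent G v v\<close> says that there is a loop at \<open>v\<close>.\<close>

definition adjacency_matrix :: "('v, 'e) graph \<Rightarrow> 'v \<Rightarrow> 'v \<Rightarrow> bit" where
  "adjacency_matrix G v w = (if adjacent G v w then 1 else 0)"

text \<open>
  Linear dependence of the columns as an indexed family: two equal columns with distinct indices
  are dependent.
\<close>

definition columns_dependent :: "'v set \<Rightarrow> ('v \<Rightarrow> 'v \<Rightarrow> bit) \<Rightarrow> 'v set \<Rightarrow> bool" where
  "columns_dependent V A S \<longleftrightarrow>
     (\<exists>x. (\<exists>w\<in>S. x w \<noteq> 0) \<and> (\<forall>v\<in>V. (\<Sum>w\<in>S. x w * A v w) = 0))"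

definition adjacency_matroid :: "('v, 'e) graph \<Rightarrow> 'v matroid" where
  "adjacency_matroid G =
     \<lparr>ground = verts G,
      circuits = minimal_sets
        {S. S \<subseteq> verts G \<and> S \<noteq> {} \<and> columns_dependent (verts G) (adjacency_matrix G) S}\<rparr>"

definition polygon_matroid :: "('v, 'e) graph \<Rightarrow> 'e matroid" where
  "polygon_matroid G =
     \<lparr>ground = edges G,
      circuits = minimal_sets {he_edge ` set hs | hs. closed_trail G hs}\<rparr>"

end

theory Submission
  imports Defs
begin

text \<open>
  Both matroids come from subspaces of \<open>GF(2)\<^sup>V\<close>, where \<open>V\<close> is the vertex set of \<open>F\<close>. The circuits of
  the dual of an adjacency matroid are the minimal nonempty sets orthogonal to the null space of the
  adjacency matrix (\<open>dual_adjacency_matroid\<close>). The circuits of a polygon matroid are the minimal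
  nonempty edge sets in which every vertex has even degree, that is, which are orthogonal to all
  coboundaries of functions on the vertices (\<open>polygon_matroid_even_sets\<close>). The theorem therefore
  follows once the null space of the adjacency matrix \<open>A\<close> of the relative interlacement graph is
  identified with the space of coboundaries of the touch-graph (\<open>null_space_eq_coboundaries\<close>).

  To this end let \<open>x\<close> be any vector indexed by \<open>V\<close>. Walk along the Euler circuits of \<open>C\<close> and label the
  edges with bits \<open>g\<close> so that the label changes by \<open>x v\<close> at each passage through \<open>v\<close>. This is consistent
  since every vertex is passed exactly twice (\<open>ex_potential\<close>). From leaving \<open>v\<close> to the next arrival
  at \<open>v\<close> the label changes by the sum of \<open>x\<close> over the vertices met exactly once in between, which are the
  vertices interlaced with \<open>v\<close> (\<open>potential_interlacement_sum\<close>). A case distinction on the type of \<open>v\<close>,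
  in which the loop of a vertex of type \<open>\<psi>\<close> supplies the missing term \<open>x v\<close>, shows that the
  \<open>v\<close>-entry of \<open>A x\<close> vanishes iff \<open>g\<close> agrees on the half-edges paired by \<open>P\<close> at \<open>v\<close>
  (\<open>adjacency_row_iff_constant_on_transition\<close>).

  So \<open>x\<close> is in the null space iff \<open>g\<close> is constant on each circuit of \<open>P\<close>, which means that \<open>g\<close> is induced
  by a function \<open>f\<close> on the vertices of the touch-graph. By compatibility the two half-edges of a passage
  of \<open>C\<close> through \<open>v\<close> belong to different pairs of \<open>P\<close>, so the jump \<open>x v\<close> is the sum of \<open>f\<close> over the two
  circuits of \<open>P\<close> at \<open>v\<close>: it is the value of the coboundary of \<open>f\<close> at the edge \<open>v\<close> of the touch-graph.
\<close>

section \<open>Duals of binary matroids\<close>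

text \<open>
  By default the simplifier turns sums and products of bits into bitwise operations, out of reach of
  the lemmas about rings and finite sums.
\<close>

declare add_bit_eq_xor [simp del] mult_bit_eq_and [simp del]

lemma bit_add_self [simp]: "(a::bit) + a = 0"
  by (cases a) simp_all

lemma bit_add_eq_0_iff: "(a::bit) + b = 0 \<longleftrightarrow> a = b"
  by (cases a; cases b) simp_all

text \<open>
  Circuits are minimal sets, so two descriptions of the circuits need not list the same sets: it
  is enough that each family refines the other.
\<close>

lemma minimal_sets_eqI:
  assumes "\<And>S. S \<in> \<S> \<Longrightarrow> \<exists>T\<in>\<T>. T \<subseteq> S" and "\<And>T. T \<in> \<T> \<Longrightarrow> \<exists>S\<in>\<S>. S \<subseteq> T"
  shows "minimal_sets \<S> = minimal_sets \<T>"
proof -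
  have "minimal_sets \<A> \<subseteq> minimal_sets \<B>"
    if AB: "\<And>S. S \<in> \<A> \<Longrightarrow> \<exists>T\<in>\<B>. T \<subseteq> S" and BA: "\<And>T. T \<in> \<B> \<Longrightarrow> \<exists>S\<in>\<A>. S \<subseteq> T"
    for \<A> \<B> :: "'a set set"
  proof
    fix S assume S: "S \<in> minimal_sets \<A>"
    have below: "T = S" if "T \<in> \<B>" "T \<subseteq> S" for T
    proof -
      from BA[OF that(1)] obtain S' where "S' \<in> \<A>" "S' \<subseteq> T" by blast
      with S that(2) have "S' = S" by (auto simp: minimal_sets_def)
      with \<open>S' \<subseteq> T\<close> that(2) show ?thesis by blast
    qed
    from S have "S \<in> \<A>" by (simp add: minimal_sets_def)
    from AB[OF this] obtain T where "T \<in> \<B>" "T \<subseteq> S" by blast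
    with below have "S \<in> \<B>" by blast
    with below show "S \<in> minimal_sets \<B>" by (auto simp: minimal_sets_def)
  qed
  from this[of \<S> \<T>, OF assms] this[of \<T> \<S>, OF assms(2,1)] show ?thesis
    by (rule equalityI)
qed

lemma ex_minimal_subset:
  assumes "finite S" "S \<in> \<S>"
  shows "\<exists>T\<in>minimal_sets \<S>. T \<subseteq> S"
  using assms
proof (induction S rule: finite_psubset_induct)
  case (psubset S)
  show ?case
  proof (cases "S \<in> minimal_sets \<S>")
    case False
    with psubset.prems obtain T where "T \<in> \<S>" "T \<subset> S" by (auto simp: minimal_sets_def)
    with psubset.IH[of T] show ?thesis by blast
  qed blast
qed

text \<open>
  A subspace \<open>K\<close> of \<open>GF(2)\<^sup>V\<close> defines a binary matroid on \<open>V\<close> whose dependent sets are those that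
  contain the nonempty support of a member of \<open>K\<close>; only the values on \<open>V\<close> matter. The
  \<open>carrier_free\<close> sets are the independent sets, and their maximal ones are the bases.
\<close>

definition carries :: "'a set \<Rightarrow> ('a \<Rightarrow> bit) set \<Rightarrow> 'a set \<Rightarrow> bool" where
  "carries V K I \<longleftrightarrow> (\<exists>x\<in>K. (\<exists>v\<in>I. x v \<noteq> 0) \<and> (\<forall>v\<in>V - I. x v = 0))"

definition carrier_free :: "'a set \<Rightarrow> ('a \<Rightarrow> bit) set \<Rightarrow> 'a set set" where
  "carrier_free V K = {I. I \<subseteq> V \<and> \<not> carries V K I}"

definition maximal_sets :: "'a set set \<Rightarrow> 'a set set" where
  "maximal_sets \<S> = {S \<in> \<S>. \<forall>T\<in>\<S>. S \<subseteq> T \<longrightarrow> T = S}"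

lemma ex_maximal_superset:
  assumes "finite V" "\<S> \<subseteq> Pow V" "S \<in> \<S>"
  shows "\<exists>T\<in>maximal_sets \<S>. S \<subseteq> T"
proof -
  have fin: "finite {T \<in> \<S>. S \<subseteq> T}"
    using assms by (auto intro: finite_subset[OF _ finite_Pow_iff[THEN iffD2]])
  have "{T \<in> \<S>. S \<subseteq> T} \<noteq> {}" using assms by blast
  from finite_has_maximal[OF fin this] show ?thesis
    by (auto simp: maximal_sets_def) (metis subset_trans)
qed

text \<open>
  A dependency that appears when \<open>w\<close> is added to an independent set must use \<open>w\<close>. For a basis
  this is the fundamental circuit of \<open>w\<close>.
\<close>

lemma carries_insert:
  assumes "\<not> carries V K B" "carries V K (insert w B)"
  shows "\<exists>x\<in>K. x w = 1 \<and> (\<forall>v\<in>V - insert w B. x v = 0)"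
proof -
  obtain x where x: "x \<in> K" "\<exists>v\<in>insert w B. x v \<noteq> 0" "\<forall>v\<in>V - insert w B. x v = 0"
    using assms(2) by (auto simp: carries_def)
  have "x w = 1"
  proof (rule ccontr)
    assume "x w \<noteq> 1"
    then have x0: "x w = 0" by simp
    have "\<exists>v\<in>B. x v \<noteq> 0" "\<forall>v\<in>V - B. x v = 0"
      using x(2,3) x0 by (auto simp: insert_iff)
    with x(1) have "carries V K B" by (auto simp: carries_def)
    with assms(1) show False by blast
  qed
  with x show ?thesis by blast
qed

lemma insert_maximal_carries:
  assumes "B \<in> maximal_sets (carrier_free V K)" "w \<in> V - B"
  shows "\<exists>x\<in>K. x w = 1 \<and> (\<forall>v\<in>V - insert w B. x v = 0)"
proof (rule carries_insert)
  show "\<not> carries V K B" using assms by (auto simp: maximal_sets_def carrier_free_def)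
  have "insert w B \<notin> carrier_free V K" using assms by (auto simp: maximal_sets_def)
  then show "carries V K (insert w B)"
    using assms by (auto simp: maximal_sets_def carrier_free_def)
qed

text \<open>
  The nonempty sets orthogonal to \<open>K\<close> are the dependencies of the dual matroid. A nonempty orthogonal \<open>T\<close> meets every basis,
  because it cannot meet the fundamental circuit of one of its elements in that element alone. If
  conversely every basis meets \<open>S\<close>, extend a maximal independent subset \<open>B\<close> of \<open>V - S\<close> to a basis
  \<open>B'\<close> and pick \<open>t\<close> in \<open>B' \<inter> S\<close>. The fundamental cocircuit of \<open>t\<close> with respect to \<open>B'\<close> is orthogonal
  to all fundamental circuits, which generate \<open>K\<close>; it lies in \<open>S\<close> because the elements outside \<open>S\<close>
  already depend on \<open>B\<close>, without \<open>t\<close>.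
\<close>

lemma maximal_avoiding_iff_no_orthogonal:
  assumes fin: "finite V"
    and add: "\<And>x y. x \<in> K \<Longrightarrow> y \<in> K \<Longrightarrow> (\<lambda>v. x v + y v) \<in> K"
    and SV: "S \<subseteq> V"
  shows "(\<exists>B\<in>maximal_sets (carrier_free V K). B \<inter> S = {}) \<longleftrightarrow>
    \<not> (\<exists>T\<subseteq>S. T \<noteq> {} \<and> (\<forall>x\<in>K. (\<Sum>v\<in>T. x v) = 0))"
    (is "?basis \<longleftrightarrow> \<not> ?orth")
proof
  assume ?basis
  then obtain B where B: "B \<in> maximal_sets (carrier_free V K)" "B \<inter> S = {}" by blast
  show "\<not> ?orth"
  proof
    assume ?orth
    then obtain T t where T: "T \<subseteq> S" "t \<in> T" "\<forall>x\<in>K. (\<Sum>v\<in>T. x v) = 0" by blast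
    have "t \<in> V - B" using T B SV by blast
    from insert_maximal_carries[OF B(1) this] obtain x
      where x: "x \<in> K" "x t = 1" "\<forall>v\<in>V - insert t B. x v = 0" by blast
    have "finite T" using T(1) SV fin by (meson finite_subset)
    then have "(\<Sum>v\<in>T. x v) = x t + (\<Sum>v\<in>T - {t}. x v)" using T by (simp add: sum.remove)
    also have "(\<Sum>v\<in>T - {t}. x v) = 0"
    proof (rule sum.neutral, rule ballI)
      fix v assume "v \<in> T - {t}"
      then have "v \<in> V - insert t B" using T(1) B(2) SV by blast
      with x(3) show "x v = 0" by blast
    qed
    finally show False using T x by simp
  qed
next
  assume no_orth: "\<not> ?orth"
  show ?basis
  proof (rule ccontr)
    assume no_basis: "\<not> ?basis"
    have free_empty: "{} \<in> carrier_free V K" by (auto simp: carrier_free_def carries_def)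
    have "\<exists>B\<in>maximal_sets {I \<in> carrier_free V K. I \<inter> S = {}}. {} \<subseteq> B"
      by (rule ex_maximal_superset[OF fin]) (use free_empty in \<open>auto simp: carrier_free_def\<close>)
    then obtain B where B: "B \<in> maximal_sets {I \<in> carrier_free V K. I \<inter> S = {}}" by blast
    then have BV: "B \<subseteq> V" and BS: "B \<inter> S = {}" and Bfree: "B \<in> carrier_free V K"
      by (auto simp: maximal_sets_def carrier_free_def)
    have "\<exists>B'\<in>maximal_sets (carrier_free V K). B \<subseteq> B'"
      by (rule ex_maximal_superset[OF fin _ Bfree]) (auto simp: carrier_free_def)
    then obtain B' where B': "B' \<in> maximal_sets (carrier_free V K)" "B \<subseteq> B'" by blast
    with no_basis obtain t where t: "t \<in> B'" "t \<in> S" by blast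
    have B'V: "B' \<subseteq> V" and B'free: "\<not> carries V K B'"
      using B' by (auto simp: maximal_sets_def carrier_free_def)
    \<comment> \<open>fundamental circuits of \<open>B'\<close>; those of elements outside \<open>S\<close> can be found inside \<open>B\<close>, so they avoid \<open>t\<close>\<close>
    have "\<exists>x. x \<in> K \<and> x w = 1 \<and> (\<forall>v\<in>V - insert w B'. x v = 0) \<and> (w \<notin> S \<longrightarrow> x t = 0)"
      if w: "w \<in> V - B'" for w
    proof (cases "w \<in> S")
      case True
      with insert_maximal_carries[OF B'(1) w] show ?thesis by blast
    next
      case False
      have wB: "w \<notin> B" using w B' by blast
      have "insert w B \<notin> {I \<in> carrier_free V K. I \<inter> S = {}}"
        using B wB by (auto simp: maximal_sets_def)
      with False BS have "insert w B \<notin> carrier_free V K" by blast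
      then have "carries V K (insert w B)" using w BV by (auto simp: carrier_free_def)
      moreover have "\<not> carries V K B" using Bfree by (simp add: carrier_free_def)
      ultimately obtain x where x: "x \<in> K" "x w = 1" "\<forall>v\<in>V - insert w B. x v = 0"
        using carries_insert[of V K B w] by metis
      moreover have "x t = 0" using x t False BS SV by blast
      ultimately show ?thesis using x B' by blast
    qed
    then obtain X where X: "X w \<in> K" "X w w = 1" "\<forall>v\<in>V - insert w B'. X w v = 0"
        "w \<notin> S \<Longrightarrow> X w t = 0" if "w \<in> V - B'" for w
      by metis
    \<comment> \<open>the fundamental cocircuit of \<open>t\<close>\<close>
    define T where "T = {v \<in> V. v = t \<or> (v \<notin> B' \<and> X v t = 1)}"
    have tV: "t \<in> V" using t B'V by blast
    have tT: "t \<in> T" using tV by (simp add: T_def)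
    have TS: "T \<subseteq> S"
    proof
      fix v assume v: "v \<in> T"
      show "v \<in> S"
      proof (rule ccontr)
        assume "v \<notin> S"
        with v t have "v \<in> V - B'" "X v t = 1" by (auto simp: T_def)
        with X(4)[of v] \<open>v \<notin> S\<close> show False by simp
      qed
    qed
    have finT: "finite T" using fin by (simp add: T_def)
    have fund: "(\<Sum>v\<in>T. X w v) = 0" if w: "w \<in> V - B'" for w
    proof -
      have wt: "w \<noteq> t" using w t by blast
      have zero: "X w v = 0" if "v \<in> T" "v \<noteq> t" "v \<noteq> w" for v
        using that X(3)[OF w] by (auto simp: T_def)
      have "(\<Sum>v\<in>T. X w v) = X w t + (\<Sum>v\<in>T - {t}. X w v)"
        using finT tT by (simp add: sum.remove)
      also have "(\<Sum>v\<in>T - {t}. X w v) = (if w \<in> T then X w w else 0)"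
      proof (cases "w \<in> T")
        case True
        then have "(\<Sum>v\<in>T - {t}. X w v) = X w w + (\<Sum>v\<in>T - {t} - {w}. X w v)"
          using finT wt by (subst sum.remove[of _ w]) auto
        also have "(\<Sum>v\<in>T - {t} - {w}. X w v) = 0"
          by (rule sum.neutral) (use zero in blast)
        finally show ?thesis using True by simp
      next
        case False
        then have "(\<Sum>v\<in>T - {t}. X w v) = 0"
          by (intro sum.neutral) (use zero in blast)
        then show ?thesis using False by simp
      qed
      also have "X w t + \<dots> = 0"
      proof (cases "X w t")
        case zero
        then have "w \<notin> T" using wt by (simp add: T_def)
        with zero show ?thesis by simp
      next
        case one
        then have "w \<in> T" using w by (auto simp: T_def)
        with one X(2)[OF w] show ?thesis by simp
      qed
      finally show ?thesis .
    qed
    have "(\<Sum>v\<in>T. x v) = 0" if "x \<in> K" for x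
      using that
    proof (induction "card {v \<in> V - B'. x v \<noteq> 0}" arbitrary: x rule: less_induct)
      case (less x)
      show ?case
      proof (cases "{v \<in> V - B'. x v \<noteq> 0} = {}")
        case True
        then have "\<forall>v\<in>V - B'. x v = 0" by blast
        with B'free less.prems have "\<forall>v\<in>B'. x v = 0" by (auto simp: carries_def)
        with \<open>\<forall>v\<in>V - B'. x v = 0\<close> show ?thesis
          by (intro sum.neutral) (auto simp: T_def)
      next
        case False
        then obtain w where w: "w \<in> V - B'" "x w = 1" by auto
        \<comment> \<open>clear the coordinate \<open>w\<close> outside the basis with the fundamental circuit of \<open>w\<close>\<close>
        let ?y = "\<lambda>v. x v + X w v"
        have "{v \<in> V - B'. ?y v \<noteq> 0} = {v \<in> V - B'. x v \<noteq> 0} - {w}"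
        proof -
          have "?y v \<noteq> 0 \<longleftrightarrow> x v \<noteq> 0 \<and> v \<noteq> w" if "v \<in> V - B'" for v
          proof (cases "v = w")
            case True
            with w X(2) show ?thesis by simp
          next
            case False
            with that X(3)[OF w(1)] show ?thesis by auto
          qed
          then show ?thesis by blast
        qed
        then have "{v \<in> V - B'. ?y v \<noteq> 0} \<subset> {v \<in> V - B'. x v \<noteq> 0}" using w by auto
        then have "card {v \<in> V - B'. ?y v \<noteq> 0} < card {v \<in> V - B'. x v \<noteq> 0}"
          using fin by (intro psubset_card_mono) auto
        then have "(\<Sum>v\<in>T. ?y v) = 0"
          by (rule less.hyps[OF _ add[OF less.prems X(1)[OF w(1)]]])
        then show ?thesis using fund[OF w(1)] by (simp add: sum.distrib)
      qed
    qed
    with no_orth TS tT show False by blast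
  qed
qed

definition null_space :: "'a set \<Rightarrow> ('a \<Rightarrow> 'a \<Rightarrow> bit) \<Rightarrow> ('a \<Rightarrow> bit) set" where
  "null_space V A = {x. \<forall>v\<in>V. (\<Sum>w\<in>V. x w * A v w) = 0}"

lemma columns_dependent_iff_carries:
  assumes "finite V" "S \<subseteq> V"
  shows "columns_dependent V A S \<longleftrightarrow> carries V (null_space V A) S"
proof
  assume "columns_dependent V A S"
  then obtain x where x: "\<exists>w\<in>S. x w \<noteq> 0" "\<forall>v\<in>V. (\<Sum>w\<in>S. x w * A v w) = 0"
    by (auto simp: columns_dependent_def)
  define y where "y w = (if w \<in> S then x w else 0)" for w
  have "(\<Sum>w\<in>V. y w * A v w) = (\<Sum>w\<in>S. x w * A v w)" for v
    by (rule sum.mono_neutral_cong_right) (use assms in \<open>auto simp: y_def\<close>)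
  with x show "carries V (null_space V A) S"
    unfolding carries_def null_space_def by (intro bexI[of _ y]) (auto simp: y_def)
next
  assume "carries V (null_space V A) S"
  then obtain x where x: "\<exists>w\<in>S. x w \<noteq> 0" "\<forall>w\<in>V - S. x w = 0"
      "\<forall>v\<in>V. (\<Sum>w\<in>V. x w * A v w) = 0"
    by (auto simp: carries_def null_space_def)
  have "(\<Sum>w\<in>V. x w * A v w) = (\<Sum>w\<in>S. x w * A v w)" for v
    by (rule sum.mono_neutral_right) (use assms x in auto)
  with x show "columns_dependent V A S" by (auto simp: columns_dependent_def)
qed

text \<open>
  A set is dependent in the dual iff no basis avoids it, that is, iff it contains a nonempty set
  orthogonal to the null space; so the minimal sets of both kinds are the same.
\<close>

lemma dual_adjacency_matroid:
  assumes fin: "finite (verts G)"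
  shows "dual (adjacency_matroid G) =
    \<lparr>ground = verts G, circuits = minimal_sets {T. T \<subseteq> verts G \<and> T \<noteq> {} \<and>
       (\<forall>x\<in>null_space (verts G) (adjacency_matrix G). (\<Sum>v\<in>T. x v) = 0)}\<rparr>"
proof -
  let ?V = "verts G" and ?M = "adjacency_matroid G"
  let ?K = "null_space ?V (adjacency_matrix G)"
  let ?dep = "{S. S \<subseteq> ?V \<and> S \<noteq> {} \<and> columns_dependent ?V (adjacency_matrix G) S}"
  have ground: "ground ?M = ?V" by (simp add: adjacency_matroid_def)
  have indep: "indep ?M I \<longleftrightarrow> I \<in> carrier_free ?V ?K" for I
  proof
    assume I: "indep ?M I"
    then have IV: "I \<subseteq> ?V" by (simp add: indep_def ground)
    have "\<not> carries ?V ?K I"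
    proof
      assume "carries ?V ?K I"
      then have "I \<in> ?dep" using IV fin by (auto simp: columns_dependent_iff_carries carries_def)
      with ex_minimal_subset[of I ?dep] IV fin finite_subset obtain T
        where "T \<in> minimal_sets ?dep" "T \<subseteq> I" by blast
      with I show False by (auto simp: indep_def adjacency_matroid_def)
    qed
    with IV show "I \<in> carrier_free ?V ?K" by (simp add: carrier_free_def)
  next
    assume "I \<in> carrier_free ?V ?K"
    then have I: "I \<subseteq> ?V" "\<not> carries ?V ?K I" by (auto simp: carrier_free_def)
    have "\<not> S \<subseteq> I" if "S \<in> minimal_sets ?dep" for S
    proof
      assume "S \<subseteq> I"
      have "carries ?V ?K S"
        using that fin by (auto simp: minimal_sets_def columns_dependent_iff_carries)
      then obtain x where x: "x \<in> ?K" "\<exists>v\<in>S. x v \<noteq> 0" "\<forall>v\<in>?V - S. x v = 0"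
        unfolding carries_def by blast
      have "carries ?V ?K I"
        unfolding carries_def using x \<open>S \<subseteq> I\<close> by (intro bexI[of _ x]) blast+
      with I show False by blast
    qed
    with I show "indep ?M I" by (auto simp: indep_def adjacency_matroid_def)
  qed
  have bases: "bases ?M = maximal_sets (carrier_free ?V ?K)"
    by (auto simp: bases_def maximal_sets_def indep)
  have add: "(\<lambda>v. x v + y v) \<in> ?K" if "x \<in> ?K" "y \<in> ?K" for x y
    using that by (simp add: null_space_def distrib_right sum.distrib)
  have codep: "(\<exists>B\<in>(\<lambda>B. ?V - B) ` bases ?M. S \<subseteq> B) \<longleftrightarrow>
      \<not> (\<exists>T\<subseteq>S. T \<noteq> {} \<and> (\<forall>x\<in>?K. (\<Sum>v\<in>T. x v) = 0))" if "S \<subseteq> ?V" for S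
  proof -
    have "S \<subseteq> ?V - B \<longleftrightarrow> B \<inter> S = {}" for B using that by blast
    then have "(\<exists>B\<in>(\<lambda>B. ?V - B) ` bases ?M. S \<subseteq> B) \<longleftrightarrow>
        (\<exists>B\<in>maximal_sets (carrier_free ?V ?K). B \<inter> S = {})"
      unfolding bases by simp
    also note maximal_avoiding_iff_no_orthogonal[OF fin add that]
    finally show ?thesis .
  qed
  have "minimal_sets {S. S \<subseteq> ?V \<and> \<not> (\<exists>B\<in>(\<lambda>B. ?V - B) ` bases ?M. S \<subseteq> B)} =
      minimal_sets {T. T \<subseteq> ?V \<and> T \<noteq> {} \<and> (\<forall>x\<in>?K. (\<Sum>v\<in>T. x v) = 0)}"
    (is "minimal_sets ?A = minimal_sets ?B")
  proof (rule minimal_sets_eqI)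
    fix S assume "S \<in> ?A"
    then have S: "S \<subseteq> ?V" "\<not> (\<exists>B\<in>(\<lambda>B. ?V - B) ` bases ?M. S \<subseteq> B)" by simp_all
    then obtain T where "T \<subseteq> S" "T \<noteq> {}" "\<forall>x\<in>?K. (\<Sum>v\<in>T. x v) = 0"
      unfolding codep[OF S(1)] by blast
    with S(1) show "\<exists>T\<in>?B. T \<subseteq> S" by (intro bexI[of _ T]) auto
  next
    fix T assume "T \<in> ?B"
    then have T: "T \<subseteq> ?V" "T \<noteq> {}" "\<forall>x\<in>?K. (\<Sum>v\<in>T. x v) = 0" by simp_all
    then have "\<not> (\<exists>B\<in>(\<lambda>B. ?V - B) ` bases ?M. S \<subseteq> B)" if "S = T" for S
      unfolding that codep[OF T(1)] by blast
    with T(1) have "T \<in> ?A" by simp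
    then show "\<exists>S\<in>?A. S \<subseteq> T" by blast
  qed
  then show ?thesis by (simp add: dual_def matroid_of_bases_def ground)
qed

section \<open>Polygon matroids and coboundaries\<close>

lemma he_edge_in_edges: "h \<in> half_edges G \<Longrightarrow> he_edge h \<in> edges G"
  by (auto simp: half_edges_def he_edge_def)

lemma half_edges_of_edge:
  assumes "finite_graph G" "e \<in> edges G"
  obtains h h' where "h \<noteq> h'" "{k \<in> half_edges G. he_edge k = e} = {h, h'}"
    "ends G e = {he_vertex h, he_vertex h'}"
proof -
  from assms consider "card (ends G e) = 1" | "card (ends G e) = 2"
    by (auto simp: finite_graph_def)
  then show thesis
  proof cases
    case 1
    then obtain v where v: "ends G e = {v}" by (auto simp: card_1_singleton_iff)
    have "k \<in> half_edges G \<and> he_edge k = e \<longleftrightarrow> k = (e, v, 0) \<or> k = (e, v, 1)" for k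
      using assms(2) v by (cases k) (auto simp: half_edges_def he_edge_def less_2_cases_iff)
    then have "{k \<in> half_edges G. he_edge k = e} = {(e, v, 0), (e, v, 1)}" by blast
    then show thesis
      by (intro that[of "(e, v, 0)" "(e, v, 1)"]) (simp_all add: v he_vertex_def)
  next
    case 2
    then obtain v w where vw: "ends G e = {v, w}" "v \<noteq> w" by (auto simp: card_2_iff)
    then have "ends G e \<noteq> {u}" for u by (metis insertI1 insert_commute singletonD)
    then have "k \<in> half_edges G \<and> he_edge k = e \<longleftrightarrow> k = (e, v, 0) \<or> k = (e, w, 0)" for k
      using assms(2) vw(1) by (cases k) (auto simp: half_edges_def he_edge_def)
    then have "{k \<in> half_edges G. he_edge k = e} = {(e, v, 0), (e, w, 0)}" by blast
    then show thesis
      using vw by (intro that[of "(e, v, 0)" "(e, w, 0)"]) (simp_all add: he_vertex_def)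
  qed
qed

lemma opposite:
  assumes "finite_graph G" "h \<in> half_edges G"
  shows opposite_in_half_edges: "opposite G h \<in> half_edges G"
    and he_edge_opposite: "he_edge (opposite G h) = he_edge h"
    and opposite_neq: "opposite G h \<noteq> h"
    and opposite_unique: "\<And>k. k \<in> half_edges G \<Longrightarrow> he_edge k = he_edge h \<Longrightarrow> k = h \<or> k = opposite G h"
    and opposite_opposite: "opposite G (opposite G h) = h"
    and ends_he_edge: "ends G (he_edge h) = {he_vertex h, he_vertex (opposite G h)}"
proof -
  from half_edges_of_edge[OF assms(1) he_edge_in_edges[OF assms(2)]]
  obtain k k' where k: "k \<noteq> k'" "{x \<in> half_edges G. he_edge x = he_edge h} = {k, k'}"
    "ends G (he_edge h) = {he_vertex k, he_vertex k'}" .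
  with assms(2) have "h = k \<or> h = k'" by blast
  then obtain h' where h': "h' \<noteq> h" "{x \<in> half_edges G. he_edge x = he_edge h} = {h, h'}"
    "ends G (he_edge h) = {he_vertex h, he_vertex h'}"
  proof
    assume "h = k"
    with k show thesis by (intro that[of k']) auto
  next
    assume "h = k'"
    with k show thesis by (intro that[of k]) auto
  qed
  have mem: "x \<in> half_edges G \<and> he_edge x = he_edge h \<longleftrightarrow> x = h \<or> x = h'" for x
    using h'(2) by blast
  have opp: "opposite G h = h'"
    unfolding opposite_def by (rule the_equality) (use mem h'(1) in blast)+
  have edge: "he_edge h' = he_edge h" and h'_in: "h' \<in> half_edges G" using mem by blast+
  have opp': "opposite G h' = h"
    unfolding opposite_def edge by (rule the_equality) (use mem h'(1) in blast)+
  show "opposite G h \<in> half_edges G" "he_edge (opposite G h) = he_edge h" "opposite G h \<noteq> h"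
    "opposite G (opposite G h) = h"
    "ends G (he_edge h) = {he_vertex h, he_vertex (opposite G h)}"
    using opp opp' edge h' h'_in by simp_all
  show "k = h \<or> k = opposite G h" if "k \<in> half_edges G" "he_edge k = he_edge h" for k
    using that mem opp by blast
qed

text \<open>
  For a graph with edge \<open>e\<close> from \<open>p\<close> to \<open>q\<close> this is the difference \<open>f p - f q\<close>, which over \<open>GF(2)\<close> is a
  sum; the case distinction makes it vanish on loops.
\<close>

definition coboundary :: "('v, 'e) graph \<Rightarrow> ('v \<Rightarrow> bit) \<Rightarrow> 'e \<Rightarrow> bit" where
  "coboundary G f e = (if card (ends G e) = 2 then \<Sum>u\<in>ends G e. f u else 0)"

lemma coboundary_ends: "ends G e = {p, q} \<Longrightarrow> coboundary G f e = f p + f q"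
  by (cases "p = q") (simp_all add: coboundary_def)

lemma sum_cyclic_shift:
  fixes f :: "nat \<Rightarrow> 'b::comm_monoid_add"
  shows "(\<Sum>i<n. f (Suc i mod n)) = (\<Sum>i<n. f i)"
proof (cases n)
  case (Suc m)
  have "(\<Sum>i<Suc m. f (Suc i mod Suc m)) = (\<Sum>i<m. f (Suc i mod Suc m)) + f 0" by simp
  also have "(\<Sum>i<m. f (Suc i mod Suc m)) = (\<Sum>i<m. f (Suc i))" by (rule sum.cong) auto
  finally show ?thesis unfolding Suc by (simp add: sum.lessThan_Suc_shift add.commute del: sum.lessThan_Suc)
qed simp

text \<open>
  Along a closed trail the coboundary telescopes: every vertex value is counted once on leaving and
  once on arriving.
\<close>

lemma closed_trail_even:
  assumes G: "finite_graph G" and hs: "closed_trail G hs"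
  shows "(\<Sum>e\<in>he_edge ` set hs. coboundary G f e) = 0"
proof -
  let ?n = "length hs"
  have "(\<Sum>e\<in>he_edge ` set hs. coboundary G f e) = (\<Sum>e\<in>set (map he_edge hs). coboundary G f e)"
    by simp
  also have "\<dots> = (\<Sum>i<?n. coboundary G f (he_edge (hs ! i)))"
    using hs unfolding closed_trail_def
    by (subst sum.distinct_set_conv_list) (auto simp: sum_list_sum_nth atLeast0LessThan)
  also have "\<dots> = (\<Sum>i<?n. f (he_vertex (hs ! i)) + f (he_vertex (hs ! (Suc i mod ?n))))"
  proof (rule sum.cong[OF refl])
    fix i assume "i \<in> {..<?n}"
    then have "i < ?n" "hs ! i \<in> half_edges G" using hs by (auto simp: closed_trail_def)
    with hs coboundary_ends[OF ends_he_edge[OF G this(2)]]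
    show "coboundary G f (he_edge (hs ! i)) = f (he_vertex (hs ! i)) + f (he_vertex (hs ! (Suc i mod ?n)))"
      by (simp add: closed_trail_def)
  qed
  also have "\<dots> = 0"
    using sum_cyclic_shift[of "\<lambda>i. f (he_vertex (hs ! i))" ?n] by (simp add: sum.distrib)
  finally show ?thesis .
qed

fun walk :: "('v, 'e) graph \<Rightarrow> 'v \<Rightarrow> ('v, 'e) half_edge list \<Rightarrow> 'v \<Rightarrow> bool" where
  "walk G u [] w \<longleftrightarrow> u = w"
| "walk G u (h # hs) w \<longleftrightarrow> he_vertex h = u \<and> walk G (he_vertex (opposite G h)) hs w"

lemma walk_append: "walk G u (xs @ ys) w \<longleftrightarrow> (\<exists>v. walk G u xs v \<and> walk G v ys w)"
  by (induction xs arbitrary: u) auto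

lemma walk_next_vertex:
  "walk G u hs w \<Longrightarrow> i < length hs \<Longrightarrow>
    he_vertex (opposite G (hs ! i)) = (if Suc i < length hs then he_vertex (hs ! Suc i) else w)"
proof (induction hs arbitrary: u i)
  case (Cons h hs)
  show ?case
  proof (cases i)
    case 0
    with Cons.prems show ?thesis by (cases hs) auto
  next
    case (Suc j)
    with Cons.prems Cons.IH[of _ j] show ?thesis by auto
  qed
qed simp

lemma closed_walk_closed_trail:
  assumes "walk G u hs u" "hs \<noteq> []" "set hs \<subseteq> half_edges G" "distinct (map he_edge hs)"
  shows "closed_trail G hs"
proof -
  have "he_vertex (hs ! 0) = u" using assms(1,2) by (cases hs) auto
  then have "he_vertex (opposite G (hs ! i)) = he_vertex (hs ! (Suc i mod length hs))"
    if "i < length hs" for i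
    using walk_next_vertex[OF assms(1) that] that
    by (cases "Suc i = length hs") (auto simp: mod_less)
  with assms show ?thesis by (simp add: closed_trail_def)
qed

text \<open>
  Choose an edge \<open>e\<close> of \<open>T\<close> and let \<open>R\<close> be the set of vertices that trails in \<open>T - {e}\<close> reach from one
  end of \<open>e\<close>. The coboundary of the indicator of \<open>R\<close> vanishes on \<open>T - {e}\<close>, so evenness makes it vanish
  on \<open>e\<close> too. Hence the other end of \<open>e\<close> lies in \<open>R\<close>, and \<open>e\<close> closes up a trail.
\<close>

lemma even_set_contains_closed_trail:
  assumes G: "finite_graph G" and T: "T \<subseteq> edges G" "T \<noteq> {}"
    and even: "\<And>f. (\<Sum>e\<in>T. coboundary G f e) = 0"
  shows "\<exists>hs. closed_trail G hs \<and> he_edge ` set hs \<subseteq> T"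
proof -
  from T obtain e where e: "e \<in> T" "e \<in> edges G" by blast
  from half_edges_of_edge[OF G e(2)] obtain h where h: "h \<in> half_edges G" "he_edge h = e"
    by (metis (mono_tags, lifting) insertI1 mem_Collect_eq)
  let ?p = "he_vertex h" and ?q = "he_vertex (opposite G h)"
  define trail_to where "trail_to u hs \<longleftrightarrow> walk G ?q hs u \<and> set hs \<subseteq> half_edges G \<and>
      he_edge ` set hs \<subseteq> T - {e} \<and> distinct (map he_edge hs)" for u hs
  define R where "R = {u. \<exists>hs. trail_to u hs}"
  have "trail_to ?q []" by (simp add: trail_to_def)
  then have qR: "?q \<in> R" by (auto simp: R_def)
  have step: "he_vertex (opposite G k) \<in> R"
    if k: "k \<in> half_edges G" "he_edge k \<in> T - {e}" and "he_vertex k \<in> R" for k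
  proof -
    from that obtain hs where hs: "trail_to (he_vertex k) hs" by (auto simp: R_def)
    \<comment> \<open>a trail that already uses the edge of \<open>k\<close> passes through both of its ends, so a prefix of it serves\<close>
    show ?thesis
    proof (cases "he_edge k \<in> he_edge ` set hs")
      case False
      with hs k have "trail_to (he_vertex (opposite G k)) (hs @ [k])"
        by (auto simp: trail_to_def walk_append)
      then show ?thesis by (auto simp: R_def)
    next
      case True
      then obtain k' where k': "k' \<in> set hs" "he_edge k' = he_edge k" by auto
      then obtain xs ys where xs: "hs = xs @ k' # ys" by (auto simp: in_set_conv_decomp)
      have "k' \<in> half_edges G" using hs k' by (auto simp: trail_to_def)
      then have "k' = k \<or> k' = opposite G k" using opposite_unique[OF G k(1)] k'(2) by blast
      moreover have "trail_to (he_vertex k') xs" "trail_to (he_vertex (opposite G k')) (xs @ [k'])"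
        using hs by (auto simp: trail_to_def xs walk_append)
      ultimately show ?thesis by (auto simp: R_def)
    qed
  qed
  define f :: "_ \<Rightarrow> bit" where "f u = (if u \<in> R then 1 else 0)" for u
  have "coboundary G f d = 0" if d: "d \<in> T - {e}" for d
  proof -
    from d T have "d \<in> edges G" by blast
    from half_edges_of_edge[OF G this] obtain k where k: "k \<in> half_edges G" "he_edge k = d"
      by (metis (mono_tags, lifting) insertI1 mem_Collect_eq)
    have "he_vertex k \<in> R \<longleftrightarrow> he_vertex (opposite G k) \<in> R"
      using step[of k] step[of "opposite G k"] k d opposite_in_half_edges[OF G k(1)]
        he_edge_opposite[OF G k(1)] opposite_opposite[OF G k(1)] by auto
    then show ?thesis
      using coboundary_ends[OF ends_he_edge[OF G k(1)], of f] k(2) by (simp add: f_def)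
  qed
  then have "(\<Sum>d\<in>T - {e}. coboundary G f d) = 0" by (intro sum.neutral) blast
  moreover have "finite T" using T G by (auto simp: finite_graph_def intro: finite_subset)
  ultimately have "coboundary G f e = 0" using even[of f] e(1) by (simp add: sum.remove)
  then have "f ?p + f ?q = 0"
    using coboundary_ends[OF ends_he_edge[OF G h(1)], of f] h(2) by simp
  then have "?p \<in> R" using qR by (auto simp: f_def split: if_splits)
  then obtain hs where hs: "trail_to ?p hs" by (auto simp: R_def)
  have "closed_trail G (h # hs)"
    by (rule closed_walk_closed_trail[of G ?p]) (use hs h in \<open>auto simp: trail_to_def\<close>)
  moreover have "he_edge ` set (h # hs) \<subseteq> T" using hs h e by (auto simp: trail_to_def)
  ultimately show ?thesis by blast
qed

lemma polygon_matroid_even_sets: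
  assumes G: "finite_graph G"
  shows "polygon_matroid G =
    \<lparr>ground = edges G, circuits = minimal_sets {T. T \<subseteq> edges G \<and> T \<noteq> {} \<and>
       (\<forall>f. (\<Sum>e\<in>T. coboundary G f e) = 0)}\<rparr>"
proof -
  have "minimal_sets {he_edge ` set hs | hs. closed_trail G hs} =
      minimal_sets {T. T \<subseteq> edges G \<and> T \<noteq> {} \<and> (\<forall>f. (\<Sum>e\<in>T. coboundary G f e) = 0)}"
    (is "minimal_sets ?A = minimal_sets ?B")
  proof (rule minimal_sets_eqI)
    fix S assume "S \<in> ?A"
    then obtain hs where hs: "S = he_edge ` set hs" "closed_trail G hs" by blast
    then have "S \<subseteq> edges G" "S \<noteq> {}"
      by (auto simp: closed_trail_def dest!: he_edge_in_edges[OF subsetD])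
    with hs closed_trail_even[OF G hs(2)] have "S \<in> ?B" by simp
    then show "\<exists>T\<in>?B. T \<subseteq> S" by blast
  next
    fix T assume "T \<in> ?B"
    then have "\<exists>hs. closed_trail G hs \<and> he_edge ` set hs \<subseteq> T"
      by (intro even_set_contains_closed_trail[OF G]) simp_all
    then show "\<exists>S\<in>?A. S \<subseteq> T" by blast
  qed
  then show ?thesis by (simp add: polygon_matroid_def)
qed

section \<open>Representatives of circuits\<close>

lemma ex_cyclic_pred:
  assumes "j < (n::nat)"
  obtains i where "i < n" "Suc i mod n = j"
proof (cases j)
  case 0
  with assms show thesis by (intro that[of "n - 1"]) auto
next
  case (Suc i)
  with assms show thesis by (intro that[of i]) auto
qed

lemma cyclic_Suc_inject:
  assumes "i < (n::nat)" "j < n" "Suc i mod n = Suc j mod n"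
  shows "i = j"
  using assms by (cases "Suc i = n"; cases "Suc j = n") auto

text \<open>
  The index \<open>i\<close> is that of
  the arriving edge, so the vertex passed is that of entry \<open>Suc i\<close>, cyclically.
\<close>

definition passage :: "('v, 'e) graph \<Rightarrow> ('v, 'e) half_edge list \<Rightarrow> nat \<Rightarrow> ('v, 'e) half_edge set" where
  "passage G hs i = {opposite G (hs ! i), hs ! (Suc i mod length hs)}"

lemma trail_transitions_passage: "trail_transitions G hs = passage G hs ` {..<length hs}"
  by (auto simp: trail_transitions_def passage_def)

lemma closed_trailD:
  assumes "closed_trail G hs"
  shows "hs \<noteq> []" "set hs \<subseteq> half_edges G" "distinct (map he_edge hs)" "0 < length hs"
    "\<And>i. i < length hs \<Longrightarrow> hs ! i \<in> half_edges G"
    "\<And>i. i < length hs \<Longrightarrow> hs ! (Suc i mod length hs) \<in> half_edges G"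
    "\<And>i. i < length hs \<Longrightarrow> Suc i mod length hs < length hs"
    "\<And>i. i < length hs \<Longrightarrow>
      he_vertex (opposite G (hs ! i)) = he_vertex (hs ! (Suc i mod length hs))"
    "\<And>i j. i < length hs \<Longrightarrow> j < length hs \<Longrightarrow> he_edge (hs ! i) = he_edge (hs ! j) \<Longrightarrow> i = j"
proof -
  show hs: "hs \<noteq> []" "set hs \<subseteq> half_edges G" "distinct (map he_edge hs)"
    using assms by (simp_all add: closed_trail_def)
  then show pos: "0 < length hs" by simp
  show lt: "Suc i mod length hs < length hs" for i using pos by simp
  show "hs ! i \<in> half_edges G" if "i < length hs" for i using hs(2) that by auto
  show "hs ! (Suc i mod length hs) \<in> half_edges G" for i using hs(2) lt by auto
  show "he_vertex (opposite G (hs ! i)) = he_vertex (hs ! (Suc i mod length hs))"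
    if "i < length hs" for i using assms that by (simp add: closed_trail_def)
  show "i = j" if "i < length hs" "j < length hs" "he_edge (hs ! i) = he_edge (hs ! j)" for i j
    using nth_eq_iff_index_eq[OF hs(3), of i j] that by simp
qed

lemma circuit_nonempty: "c \<in> graph_circuits G \<Longrightarrow> \<exists>hs. hs \<in> c"
  by (auto simp: graph_circuits_def circuit_of_def intro: exI[of _ 0])

context
  fixes G :: "('v, 'e) graph"
  assumes G: "finite_graph G"
begin

lemma opposite_not_on_trail:
  assumes "closed_trail G hs" "h \<in> set hs"
  shows "opposite G h \<notin> set hs"
proof
  assume "opposite G h \<in> set hs"
  then obtain i j where "i < length hs" "hs ! i = h" "j < length hs" "hs ! j = opposite G h"
    using assms(2) by (auto simp: in_set_conv_nth)
  moreover have h: "h \<in> half_edges G" using assms closed_trailD(2) by blast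
  ultimately have "i = j"
    using closed_trailD(9)[OF assms(1), of i j] he_edge_opposite[OF G h] by simp
  with \<open>hs ! i = h\<close> \<open>hs ! j = opposite G h\<close> opposite_neq[OF G h] show False by simp
qed

text \<open>
  The passages of a closed trail are pairwise disjoint: a half-edge determines its edge, which occurs
  only once on the trail, and the direction in which that edge is traversed tells whether the trail
  arrives or leaves by this half-edge.
\<close>

lemma passage_index_unique:
  assumes hs: "closed_trail G hs" and ij: "i < length hs" "j < length hs"
    and h: "h \<in> passage G hs i" "h \<in> passage G hs j"
  shows "i = j"
proof -
  note D = closed_trailD[OF hs]
  have opp: "he_edge (opposite G (hs ! k)) = he_edge (hs ! k)"
    "opposite G (hs ! k) \<noteq> hs ! (Suc m mod length hs)" if "k < length hs" for k m
  proof -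
    show "he_edge (opposite G (hs ! k)) = he_edge (hs ! k)"
      using he_edge_opposite[OF G D(5)[OF that]] .
    have "hs ! (Suc m mod length hs) \<in> set hs" using D(4) by simp
    moreover have "opposite G (hs ! k) \<notin> set hs"
      using opposite_not_on_trail[OF hs] that by simp
    ultimately show "opposite G (hs ! k) \<noteq> hs ! (Suc m mod length hs)" by metis
  qed
  from h consider "opposite G (hs ! i) = opposite G (hs ! j)"
    | "hs ! (Suc i mod length hs) = hs ! (Suc j mod length hs)"
    using opp(2)[OF ij(1), of j] opp(2)[OF ij(2), of i] unfolding passage_def by auto
  then show ?thesis
  proof cases
    case 1
    then show ?thesis using opp(1)[OF ij(1)] opp(1)[OF ij(2)] D(9)[OF ij] by simp
  next
    case 2
    then show ?thesis using D(9)[OF D(7)[OF ij(1)] D(7)[OF ij(2)]] cyclic_Suc_inject[OF ij] by simp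
  qed
qed

lemma card_passage:
  assumes hs: "closed_trail G hs" and i: "i < length hs"
  shows "card (passage G hs i) = 2"
proof -
  have "hs ! (Suc i mod length hs) \<in> set hs" using closed_trailD(4)[OF hs] by simp
  moreover have "opposite G (hs ! i) \<notin> set hs" using opposite_not_on_trail[OF hs] i by simp
  ultimately have "opposite G (hs ! i) \<noteq> hs ! (Suc i mod length hs)" by metis
  then show ?thesis by (simp add: passage_def)
qed

lemma passage_at_vertex:
  assumes hs: "closed_trail G hs" and i: "i < length hs"
  shows "passage G hs i \<subseteq> half_edges_at G (he_vertex (hs ! (Suc i mod length hs)))"
  using closed_trailD[OF hs] i opposite_in_half_edges[OF G closed_trailD(5)[OF hs i]]
  by (auto simp: passage_def half_edges_at_def)

lemma he_edge_passage:
  assumes hs: "closed_trail G hs" and i: "i < length hs" and h: "h \<in> passage G hs i"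
  shows "he_edge h \<in> he_edge ` set hs"
proof -
  have "hs ! i \<in> set hs" "hs ! (Suc i mod length hs) \<in> set hs"
    using i closed_trailD(4)[OF hs] by simp_all
  then show ?thesis
    using h he_edge_opposite[OF G closed_trailD(5)[OF hs i]] by (auto simp: passage_def)
qed

lemma ex_passage:
  assumes hs: "closed_trail G hs" and h: "h \<in> half_edges G" "he_edge h \<in> he_edge ` set hs"
  obtains i where "i < length hs" "h \<in> passage G hs i"
proof -
  note D = closed_trailD[OF hs]
  from h(2) obtain j where j: "j < length hs" "he_edge h = he_edge (hs ! j)"
    by (auto simp: in_set_conv_nth)
  from opposite_unique[OF G D(5)[OF j(1)] h(1) j(2)] show thesis
  proof
    assume "h = hs ! j"
    moreover from ex_cyclic_pred[OF j(1)] obtain i where "i < length hs" "Suc i mod length hs = j" .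
    ultimately show thesis by (intro that[of i]) (auto simp: passage_def)
  next
    assume "h = opposite G (hs ! j)"
    with j show thesis by (intro that[of j]) (auto simp: passage_def)
  qed
qed

text \<open>
  Changing the starting point or the direction changes neither the passages nor the edges. Hence any
  list in a circuit represents it equally well, as \<open>circuit_representative\<close> below records.
\<close>

lemma closed_trail_rotate:
  assumes hs: "closed_trail G hs"
  shows "closed_trail G (rotate m hs)" "trail_transitions G (rotate m hs) = trail_transitions G hs"
proof -
  let ?n = "length hs"
  note D = closed_trailD[OF hs]
  have nth: "rotate k xs ! i = xs ! ((k + i) mod length xs)"
    "rotate k xs ! (Suc i mod length xs) = xs ! (Suc ((k + i) mod length xs) mod length xs)"
    if "i < length xs" for k i and xs :: "('v, 'e) half_edge list"
  proof -
    show "rotate k xs ! i = xs ! ((k + i) mod length xs)" using that by (rule nth_rotate)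
    have "Suc i mod length xs < length xs" using that by (intro mod_less_divisor) linarith
    then have "rotate k xs ! (Suc i mod length xs) = xs ! ((k + Suc i mod length xs) mod length xs)"
      by (rule nth_rotate)
    then show "rotate k xs ! (Suc i mod length xs) = xs ! (Suc ((k + i) mod length xs) mod length xs)"
      by (simp add: mod_simps)
  qed
  have "distinct (map he_edge (rotate m hs))" using D(3) by (simp flip: rotate_map)
  moreover have "he_vertex (opposite G (rotate m hs ! i)) = he_vertex (rotate m hs ! (Suc i mod ?n))"
    if "i < ?n" for i
    unfolding nth[OF that] using D(4) by (intro D(8)) simp
  ultimately show "closed_trail G (rotate m hs)"
    using D(1,2) by (simp add: closed_trail_def)
  have sub: "trail_transitions G (rotate k xs) \<subseteq> trail_transitions G xs"
    for k and xs :: "('v, 'e) half_edge list"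
  proof
    fix t assume "t \<in> trail_transitions G (rotate k xs)"
    then obtain i where i: "i < length xs" "t = passage G (rotate k xs) i"
      by (auto simp: trail_transitions_passage)
    then have "t = passage G xs ((k + i) mod length xs)" by (simp add: passage_def nth)
    moreover have "(k + i) mod length xs < length xs"
      using i(1) by (intro mod_less_divisor) linarith
    ultimately show "t \<in> trail_transitions G xs" by (auto simp: trail_transitions_passage)
  qed
  \<comment> \<open>\<open>hs\<close> is itself a rotation of \<open>rotate m hs\<close>, which turns the inclusion into an equality\<close>
  have "m \<le> ?n * m" using D(4) by (simp add: Suc_leI)
  then have "rotate (?n * m - m) (rotate m hs) = hs" by (simp add: rotate_rotate)
  with sub[of "?n * m - m" "rotate m hs"] sub[of m hs]
  show "trail_transitions G (rotate m hs) = trail_transitions G hs" by simp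
qed

lemma closed_trail_reverse:
  assumes hs: "closed_trail G hs"
  shows "closed_trail G (map (opposite G) (rev hs))"
    "trail_transitions G (map (opposite G) (rev hs)) = trail_transitions G hs"
    "he_edge ` set (map (opposite G) (rev hs)) = he_edge ` set hs"
proof -
  let ?r = "\<lambda>xs. map (opposite G) (rev xs)"
  note D = closed_trailD[OF hs]
  have edges: "map he_edge (?r hs) = rev (map he_edge hs)"
    using D(2) he_edge_opposite[OF G] by (auto simp: rev_map[symmetric] subset_iff)
  then show "he_edge ` set (?r hs) = he_edge ` set hs" by (metis list.set_map set_rev)
  have rev_rev: "?r (?r xs) = xs" if "set xs \<subseteq> half_edges G" for xs
    using that opposite_opposite[OF G] by (auto simp: rev_map intro!: map_idI)
  have passage: "passage G (?r xs) i = passage G xs (length xs - Suc (Suc i mod length xs))"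
    and out: "opposite G (?r xs ! i) = xs ! (length xs - Suc i)"
    and nxt: "?r xs ! (Suc i mod length xs) = opposite G (xs ! (length xs - Suc (Suc i mod length xs)))"
    if xs: "set xs \<subseteq> half_edges G" and i: "i < length xs" for xs i
  proof -
    let ?k = "length xs"
    have lt: "Suc i mod ?k < ?k" using i by (intro mod_less_divisor) linarith
    show out: "opposite G (?r xs ! i) = xs ! (?k - Suc i)"
    proof -
      have "xs ! (?k - Suc i) \<in> half_edges G" using i xs by (intro subsetD[OF xs] nth_mem) simp
      with i opposite_opposite[OF G] show ?thesis by (simp add: rev_nth)
    qed
    show nxt: "?r xs ! (Suc i mod ?k) = opposite G (xs ! (?k - Suc (Suc i mod ?k)))"
      using lt by (simp add: rev_nth)
    have "Suc (?k - Suc (Suc i mod ?k)) mod ?k = ?k - Suc i"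
    proof (cases "Suc i = ?k")
      case True
      then have "Suc (?k - Suc (Suc i mod ?k)) = ?k" by simp
      with True show ?thesis by simp
    next
      case False
      with i have "Suc i < ?k" by simp
      then have "Suc (?k - Suc (Suc i mod ?k)) = ?k - Suc i" by simp
      with \<open>Suc i < ?k\<close> show ?thesis by simp
    qed
    then show "passage G (?r xs) i = passage G xs (?k - Suc (Suc i mod ?k))"
      using out nxt by (auto simp: passage_def)
  qed
  have sub: "trail_transitions G (?r xs) \<subseteq> trail_transitions G xs" if "set xs \<subseteq> half_edges G" for xs
    using passage[OF that] by (auto simp: trail_transitions_passage)
  have set_r: "set (?r hs) \<subseteq> half_edges G" using D(2) opposite_in_half_edges[OF G] by auto
  show "trail_transitions G (?r hs) = trail_transitions G hs"
    using sub[OF D(2)] sub[OF set_r] rev_rev[OF D(2)] by simp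
  have "he_vertex (opposite G (?r hs ! i)) = he_vertex (?r hs ! (Suc i mod length hs))"
    if i: "i < length hs" for i
  proof -
    let ?j = "length hs - Suc (Suc i mod length hs)"
    have j: "?j < length hs" using D(4) by simp
    have "passage G (?r hs) i \<subseteq> half_edges_at G (he_vertex (hs ! (Suc ?j mod length hs)))"
      using passage[OF D(2) i] passage_at_vertex[OF hs j] by simp
    then show ?thesis by (auto simp: passage_def half_edges_at_def)
  qed
  then show "closed_trail G (?r hs)"
    using D set_r edges by (simp add: closed_trail_def)
qed

lemma circuit_representative:
  assumes c: "c \<in> graph_circuits G" and hs: "hs \<in> c"
  shows "closed_trail G hs" "circuit_edges c = he_edge ` set hs"
    "circuit_transitions G c = trail_transitions G hs" "rotate m hs \<in> c"
proof -
  from c obtain xs where xs: "closed_trail G xs" "c = circuit_of G xs"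
    by (auto simp: graph_circuits_def)
  have all_reps: "closed_trail G ys \<and> he_edge ` set ys = he_edge ` set xs \<and>
      trail_transitions G ys = trail_transitions G xs" if "ys \<in> c" for ys
    using that closed_trail_rotate[OF xs(1)] closed_trail_reverse[OF xs(1)]
      closed_trail_rotate[OF closed_trail_reverse(1)[OF xs(1)]]
    by (auto simp: xs(2) circuit_of_def)
  then show "closed_trail G hs" using hs by blast
  show "circuit_edges c = he_edge ` set hs"
    unfolding circuit_edges_def using all_reps hs by auto
  show "circuit_transitions G c = trail_transitions G hs"
    unfolding circuit_transitions_def using all_reps hs by auto
  show "rotate m hs \<in> c" using hs by (auto simp: xs(2) circuit_of_def rotate_rotate)
qed

lemma circuit_vertices_iff:
  assumes c: "c \<in> graph_circuits G"
  shows "v \<in> circuit_vertices c \<longleftrightarrow> (\<exists>h\<in>half_edges_at G v. he_edge h \<in> circuit_edges c)"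
proof
  assume "v \<in> circuit_vertices c"
  then obtain hs h where h: "hs \<in> c" "h \<in> set hs" "he_vertex h = v"
    by (auto simp: circuit_vertices_def)
  note rep = circuit_representative[OF c h(1)]
  have "h \<in> half_edges G" using closed_trailD(2)[OF rep(1)] h(2) by blast
  with h rep(2) show "\<exists>h\<in>half_edges_at G v. he_edge h \<in> circuit_edges c"
    by (intro bexI[of _ h]) (auto simp: half_edges_at_def)
next
  assume "\<exists>h\<in>half_edges_at G v. he_edge h \<in> circuit_edges c"
  then obtain h where h: "h \<in> half_edges G" "he_vertex h = v" "he_edge h \<in> circuit_edges c"
    by (auto simp: half_edges_at_def)
  obtain hs where hs: "hs \<in> c" using circuit_nonempty[OF c] by blast
  note rep = circuit_representative[OF c hs]
  from ex_passage[OF rep(1) h(1)] h(3) rep(2) obtain i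
    where i: "i < length hs" "h \<in> passage G hs i" by auto
  with passage_at_vertex[OF rep(1) i(1)] h(2) have "v = he_vertex (hs ! (Suc i mod length hs))"
    by (auto simp: half_edges_at_def)
  moreover have "hs ! (Suc i mod length hs) \<in> set hs" using closed_trailD(4)[OF rep(1)] by simp
  ultimately show "v \<in> circuit_vertices c" using hs by (auto simp: circuit_vertices_def)
qed

end

section \<open>Transitions of a circuit partition\<close>

text \<open>
  There are three ways to pair the four half-edges at a vertex; this underlies the three types of
  transitions.
\<close>

lemma partition_on_four_pairs:
  assumes part: "partition_on {a, b, c, d} X" and dist: "distinct [a, b, c, d]"
    and two: "\<And>t. t \<in> X \<Longrightarrow> card t = 2"
  shows "X = {{a, b}, {c, d}} \<or> X = {{a, c}, {b, d}} \<or> X = {{a, d}, {b, c}}"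
proof -
  have union: "\<Union>X = {a, b, c, d}" and disj: "\<And>s t. s \<in> X \<Longrightarrow> t \<in> X \<Longrightarrow> s \<noteq> t \<Longrightarrow> s \<inter> t = {}"
    using part by (auto simp: partition_on_def disjoint_def)
  have split: "X = {{a, y}, {p, q}}"
    if y: "{a, y} \<in> X" and pq: "{a, b, c, d} - {a, y} = {p, q}" "p \<noteq> q" for y p q
  proof -
    have rest: "t = {p, q}" if t: "t \<in> X" "t \<noteq> {a, y}" for t
    proof -
      have "t \<inter> {a, y} = {}" using disj[OF t(1) y t(2)] .
      moreover have "t \<subseteq> {a, b, c, d}" using t union by blast
      ultimately have "t \<subseteq> {p, q}" using pq(1) by blast
      then show ?thesis using two[OF t(1)] pq(2) by (intro card_subset_eq) auto
    qed
    have "p \<in> \<Union>X" "p \<notin> {a, y}" using union pq(1) by blast+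
    then obtain t where "t \<in> X" "t \<noteq> {a, y}" by blast
    with rest y show ?thesis by blast
  qed
  have "a \<in> \<Union>X" using union by blast
  then obtain t where t: "t \<in> X" "a \<in> t" by blast
  from two[OF t(1)] t(2) obtain y where y: "t = {a, y}" "y \<noteq> a"
    by (auto simp: card_2_iff doubleton_eq_iff)
  then have "y \<in> {a, b, c, d}" using t union by blast
  with y(2) consider "y = b" | "y = c" | "y = d" by blast
  then show ?thesis
  proof cases
    case 1
    have "{a, b, c, d} - {a, y} = {c, d}" using dist 1 by auto
    from split[OF _ this] t y 1 dist show ?thesis by simp
  next
    case 2
    have "{a, b, c, d} - {a, y} = {b, d}" using dist 2 by auto
    from split[OF _ this] t y 2 dist show ?thesis by simp
  next
    case 3
    have "{a, b, c, d} - {a, y} = {b, c}" using dist 3 by auto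
    from split[OF _ this] t y 3 dist show ?thesis by simp
  qed
qed

locale partitioned_graph =
  fixes F :: "('v, 'e) graph" and Q :: "('v, 'e) circuit set"
  assumes G: "finite_graph F" and partition: "circuit_partition F Q"
begin

definition circuit_through :: "'e \<Rightarrow> ('v, 'e) circuit" where
  "circuit_through e = (THE c. c \<in> Q \<and> e \<in> circuit_edges c)"

lemma in_graph_circuits: "c \<in> Q \<Longrightarrow> c \<in> graph_circuits F"
  using partition by (auto simp: circuit_partition_def)

lemma ex_representative: "c \<in> Q \<Longrightarrow> \<exists>hs. hs \<in> c"
  using circuit_nonempty in_graph_circuits by blast

lemma circuit_through_eq: "c \<in> Q \<Longrightarrow> e \<in> circuit_edges c \<Longrightarrow> circuit_through e = c"
  unfolding circuit_through_def
proof (rule the_equality)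
  assume c: "c \<in> Q" "e \<in> circuit_edges c"
  then show "c \<in> Q \<and> e \<in> circuit_edges c" by simp
  fix d assume d: "d \<in> Q \<and> e \<in> circuit_edges d"
  have "disjoint_family_on circuit_edges Q" using partition by (simp add: circuit_partition_def)
  with c d show "d = c" by (meson disjoint_family_onD disjoint_iff)
qed

lemma circuit_through:
  assumes "h \<in> half_edges F"
  shows "circuit_through (he_edge h) \<in> Q" "he_edge h \<in> circuit_edges (circuit_through (he_edge h))"
proof -
  have "he_edge h \<in> (\<Union>c\<in>Q. circuit_edges c)"
    using he_edge_in_edges[OF assms] partition by (simp add: circuit_partition_def)
  then obtain c where "c \<in> Q" "he_edge h \<in> circuit_edges c" by blast
  with circuit_through_eq
  show "circuit_through (he_edge h) \<in> Q" "he_edge h \<in> circuit_edges (circuit_through (he_edge h))"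
    by simp_all
qed

lemma representative:
  assumes "c \<in> Q" "hs \<in> c"
  shows "closed_trail F hs" "circuit_edges c = he_edge ` set hs"
    "circuit_transitions F c = passage F hs ` {..<length hs}" "\<And>m. rotate m hs \<in> c"
  using circuit_representative[OF G in_graph_circuits[OF assms(1)] assms(2)]
  by (simp_all add: trail_transitions_passage)

lemma he_vertex_in_verts: "h \<in> half_edges F \<Longrightarrow> he_vertex h \<in> verts F"
proof -
  assume h: "h \<in> half_edges F"
  have "ends F (he_edge h) \<subseteq> verts F"
    using G he_edge_in_edges[OF h] by (simp add: finite_graph_def)
  then show ?thesis using ends_he_edge[OF G h] by simp
qed

lemma half_edges_atD:
  assumes "h \<in> half_edges_at F v"
  shows "h \<in> half_edges F" "he_vertex h = v" "v \<in> verts F"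
proof -
  show h: "h \<in> half_edges F" "he_vertex h = v" using assms by (simp_all add: half_edges_at_def)
  then show "v \<in> verts F" using he_vertex_in_verts[OF h(1)] by simp
qed

lemma passage_in_transition:
  assumes c: "c \<in> Q" "hs \<in> c" and i: "i < length hs"
  shows "passage F hs i \<in> transition F Q (he_vertex (hs ! (Suc i mod length hs)))"
  using passage_at_vertex[OF G representative(1)[OF c] i] c representative(3)[OF c] i
  by (auto simp: transition_def)

text \<open>
  This ties transitions to positions in a list. No other circuit of the partition has an edge of \<open>c\<close>,
  so the transition stems from \<open>c\<close>, and all representatives of \<open>c\<close> have the same passages.
\<close>

lemma transition_passage:
  assumes t: "t \<in> transition F Q v" "h \<in> t" and c: "he_edge h \<in> circuit_edges c" "c \<in> Q" "hs \<in> c"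
  obtains i where "i < length hs" "t = passage F hs i" "he_vertex (hs ! (Suc i mod length hs)) = v"
proof -
  from t obtain c' where c': "c' \<in> Q" "t \<in> circuit_transitions F c'" by (auto simp: transition_def)
  obtain hs' where hs': "hs' \<in> c'" using ex_representative[OF c'(1)] by blast
  note rep' = representative[OF c'(1) hs']
  from c'(2) obtain i where i: "i < length hs'" "t = passage F hs' i" using rep'(3) by auto
  have "he_edge h \<in> circuit_edges c'"
    using he_edge_passage[OF G rep'(1) i(1)] t(2) i(2) rep'(2) by simp
  then have "c' = c" using circuit_through_eq c' c by metis
  then have "t \<in> circuit_transitions F c" using c' by simp
  then obtain j where j: "j < length hs" "t = passage F hs j" using representative(3)[OF c(2,3)] by auto
  have "hs ! (Suc j mod length hs) \<in> t" by (simp add: j passage_def)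
  moreover have "t \<subseteq> half_edges_at F v" using t by (auto simp: transition_def)
  ultimately have "he_vertex (hs ! (Suc j mod length hs)) = v" by (auto simp: half_edges_at_def)
  with j show thesis by (rule that)
qed

lemma transition_subset: "t \<in> transition F Q v \<Longrightarrow> t \<subseteq> half_edges_at F v"
  by (simp add: transition_def)

lemma transition_cover:
  assumes h: "h \<in> half_edges_at F v"
  obtains t where "t \<in> transition F Q v" "h \<in> t"
proof -
  have hF: "h \<in> half_edges F" and hv: "he_vertex h = v" using h by (auto simp: half_edges_at_def)
  note c = circuit_through[OF hF]
  obtain hs where hs: "hs \<in> circuit_through (he_edge h)"
    using ex_representative[OF c(1)] by blast
  note rep = representative[OF c(1) hs]
  from ex_passage[OF G rep(1) hF] c(2) rep(2) obtain i
    where i: "i < length hs" "h \<in> passage F hs i" by auto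
  have "he_vertex (hs ! (Suc i mod length hs)) = v"
    using passage_at_vertex[OF G rep(1) i(1)] i(2) hv by (auto simp: half_edges_at_def)
  with passage_in_transition[OF c(1) hs i(1)] i(2) show thesis by (intro that) auto
qed

lemma transition_half_edge_circuit:
  assumes "t \<in> transition F Q v" "h \<in> t" "h' \<in> t"
  shows "circuit_through (he_edge h') = circuit_through (he_edge h)"
proof -
  have hF: "h \<in> half_edges F" using transition_subset assms by (auto simp: half_edges_at_def)
  note c = circuit_through[OF hF]
  obtain hs where hs: "hs \<in> circuit_through (he_edge h)"
    using ex_representative[OF c(1)] by blast
  note rep = representative[OF c(1) hs]
  obtain i where i: "i < length hs" "t = passage F hs i"
    by (rule transition_passage[OF assms(1,2) c(2,1) hs])
  have "he_edge h' \<in> circuit_edges (circuit_through (he_edge h))"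
    using he_edge_passage[OF G rep(1) i(1)] assms(3) i(2) rep(2) by simp
  then show ?thesis by (rule circuit_through_eq[OF c(1)])
qed

lemma transition_unique:
  assumes t: "t \<in> transition F Q v" "h \<in> t" and t': "t' \<in> transition F Q v'" "h \<in> t'"
  shows "t = t'"
proof -
  have hF: "h \<in> half_edges F" using transition_subset t by (auto simp: half_edges_at_def)
  note c = circuit_through[OF hF]
  obtain hs where hs: "hs \<in> circuit_through (he_edge h)"
    using ex_representative[OF c(1)] by blast
  obtain i where i: "i < length hs" "t = passage F hs i"
    by (rule transition_passage[OF t c(2,1) hs])
  obtain j where j: "j < length hs" "t' = passage F hs j"
    by (rule transition_passage[OF t' c(2,1) hs])
  have "i = j"
    using passage_index_unique[OF G representative(1)[OF c(1) hs] i(1) j(1)] t(2) t'(2) i(2) j(2)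
    by simp
  with i j show ?thesis by simp
qed

lemma card_transition:
  assumes "t \<in> transition F Q v"
  shows "card t = 2"
proof -
  from assms obtain c where c: "c \<in> Q" "t \<in> circuit_transitions F c" by (auto simp: transition_def)
  obtain hs where hs: "hs \<in> c" using ex_representative[OF c(1)] by blast
  from c(2) obtain i where "i < length hs" "t = passage F hs i"
    using representative(3)[OF c(1) hs] by auto
  with card_passage[OF G representative(1)[OF c(1) hs]] show ?thesis by simp
qed

lemma partition_on_transition: "partition_on (half_edges_at F v) (transition F Q v)"
proof (rule partition_onI)
  show "{} \<notin> transition F Q v" using card_transition by fastforce
  show "disjnt s t" if "s \<in> transition F Q v" "t \<in> transition F Q v" "s \<noteq> t" for s t
    using transition_unique[OF that(1) _ that(2)] that(3) by (meson disjnt_iff)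
  show "\<Union>(transition F Q v) = half_edges_at F v"
  proof
    show "\<Union>(transition F Q v) \<subseteq> half_edges_at F v" using transition_subset by blast
    show "half_edges_at F v \<subseteq> \<Union>(transition F Q v)"
    proof
      fix h assume "h \<in> half_edges_at F v"
      then obtain t where "t \<in> transition F Q v" "h \<in> t" by (rule transition_cover)
      then show "h \<in> \<Union>(transition F Q v)" by blast
    qed
  qed
qed

lemma transition_of_four:
  assumes "half_edges_at F v = {a, b, c, d}" "distinct [a, b, c, d]"
  shows "transition F Q v \<in> {{{a, b}, {c, d}}, {{a, c}, {b, d}}, {{a, d}, {b, c}}}"
proof -
  have "partition_on {a, b, c, d} (transition F Q v)"
    using partition_on_transition[of v] unfolding assms(1) .
  from partition_on_four_pairs[OF this assms(2) card_transition] show ?thesis by simp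
qed

text \<open>
  Consecutive edges of a circuit are paired by a transition, so a function of edges that respects
  all transitions depends on the circuit only.
\<close>

lemma constant_on_circuits:
  assumes const: "\<And>v t h h'. t \<in> transition F Q v \<Longrightarrow> h \<in> t \<Longrightarrow> h' \<in> t \<Longrightarrow>
      g (he_edge h) = g (he_edge h')"
    and c: "c \<in> Q" and e: "e \<in> circuit_edges c" "e' \<in> circuit_edges c"
  shows "g e = g e'"
proof -
  obtain hs where hs: "hs \<in> c" using ex_representative[OF c] by blast
  note rep = representative[OF c hs] and D = closed_trailD[OF representative(1)[OF c hs]]
  have "g (he_edge (hs ! i)) = g (he_edge (hs ! 0))" if "i < length hs" for i
    using that
  proof (induction i)
    case (Suc i)
    then have i: "i < length hs" "Suc i mod length hs = Suc i" by simp_all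
    have "g (he_edge (opposite F (hs ! i))) = g (he_edge (hs ! Suc i))"
      by (rule const[OF passage_in_transition[OF c hs i(1)]]) (use i in \<open>simp_all add: passage_def\<close>)
    then show ?case using Suc.IH i he_edge_opposite[OF G D(5)[OF i(1)]] by simp
  qed simp
  then have "g e = g (he_edge (hs ! 0))" if "e \<in> circuit_edges c" for e
  proof -
    from that rep(2) obtain h where "h \<in> set hs" "e = he_edge h" by blast
    with \<open>\<And>i. i < length hs \<Longrightarrow> g (he_edge (hs ! i)) = g (he_edge (hs ! 0))\<close>
    show ?thesis by (metis in_set_conv_nth)
  qed
  with e show ?thesis by simp
qed

lemma finite_circuits: "finite Q"
proof -
  have "inj_on circuit_edges Q"
  proof (rule inj_onI)
    fix c c' assume cc: "c \<in> Q" "c' \<in> Q" "circuit_edges c = circuit_edges c'"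
    obtain hs where hs: "hs \<in> c" using ex_representative[OF cc(1)] by blast
    have "hs ! 0 \<in> set hs" using closed_trailD(4)[OF representative(1)[OF cc(1) hs]] by simp
    then have "he_edge (hs ! 0) \<in> circuit_edges c" using representative(2)[OF cc(1) hs] by simp
    with cc circuit_through_eq show "c = c'" by metis
  qed
  moreover have "circuit_edges ` Q \<subseteq> Pow (edges F)"
    using partition by (auto simp: circuit_partition_def)
  moreover have "finite (Pow (edges F))" using G by (simp add: finite_graph_def)
  ultimately show ?thesis by (meson finite_imageD finite_subset)
qed

lemma touch_graph_ends:
  "ends (touch_graph F Q) v = (\<lambda>h. circuit_through (he_edge h)) ` half_edges_at F v"
proof -
  have "c \<in> Q \<and> v \<in> circuit_vertices c \<longleftrightarrow>
      (\<exists>h\<in>half_edges_at F v. c = circuit_through (he_edge h))" for c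
  proof
    assume c: "c \<in> Q \<and> v \<in> circuit_vertices c"
    then show "\<exists>h\<in>half_edges_at F v. c = circuit_through (he_edge h)"
      using circuit_vertices_iff[OF G in_graph_circuits] circuit_through_eq by metis
  next
    assume "\<exists>h\<in>half_edges_at F v. c = circuit_through (he_edge h)"
    then obtain h where h: "h \<in> half_edges_at F v" "c = circuit_through (he_edge h)" by blast
    then have "h \<in> half_edges F" by (simp add: half_edges_at_def)
    from circuit_through[OF this] h show "c \<in> Q \<and> v \<in> circuit_vertices c"
      using circuit_vertices_iff[OF G in_graph_circuits, of c v] by auto
  qed
  then show ?thesis by (auto simp: touch_graph_def)
qed

end

section \<open>Potentials along an Euler system\<close>

lemma of_nat_bit: "(of_nat n :: bit) = of_bool (odd n)"
  by (induction n) auto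

locale euler_graph = partitioned_graph F C
  for F :: "('v, 'e) graph" and C :: "('v, 'e) circuit set" +
  assumes four: "four_regular F" and euler: "euler_system F C"
begin

text \<open>
  All edges at \<open>v\<close> lie in the component of \<open>v\<close>, hence on its Euler circuit.
\<close>

lemma circuit_at_vertex:
  assumes v: "v \<in> verts F"
  obtains c where "c \<in> C" "\<And>h. h \<in> half_edges_at F v \<Longrightarrow> he_edge h \<in> circuit_edges c"
proof -
  define R where "R = {(v, w). v \<in> verts F \<and> w \<in> verts F \<and> (adjacent F)\<^sup>*\<^sup>* v w}"
  have "R `` {v} \<in> components F" using v unfolding components_def R_def by (rule quotientI)
  then obtain c where c: "c \<in> C" "euler_circuit F (R `` {v}) c"
    using euler unfolding euler_system_def by blast
  have "he_edge h \<in> circuit_edges c" if h: "h \<in> half_edges_at F v" for h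
  proof -
    have hF: "h \<in> half_edges F" and hv: "he_vertex h = v" using h by (auto simp: half_edges_at_def)
    let ?w = "he_vertex (opposite F h)"
    have ends: "ends F (he_edge h) = {v, ?w}" using ends_he_edge[OF G hF] hv by simp
    then have "adjacent F v ?w" using he_edge_in_edges[OF hF] by (auto simp: adjacent_def)
    moreover have "?w \<in> verts F" by (rule he_vertex_in_verts[OF opposite_in_half_edges[OF G hF]])
    ultimately have "ends F (he_edge h) \<subseteq> R `` {v}" using v ends by (auto simp: R_def)
    then show ?thesis using c(2) he_edge_in_edges[OF hF] by (simp add: euler_circuit_def edges_within_def)
  qed
  with c(1) show thesis by (rule that)
qed

lemma edges_at_vertex_same_circuit:
  assumes c: "c \<in> C" and h: "h \<in> half_edges_at F v" "he_edge h \<in> circuit_edges c"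
    and h': "h' \<in> half_edges_at F v"
  shows "he_edge h' \<in> circuit_edges c"
proof -
  have "v \<in> verts F" by (rule half_edges_atD(3)[OF h(1)])
  then obtain d where d: "d \<in> C" "\<And>h. h \<in> half_edges_at F v \<Longrightarrow> he_edge h \<in> circuit_edges d"
    using circuit_at_vertex by blast
  then have "d = c" using circuit_through_eq[OF c h(2)] circuit_through_eq[OF d(1) d(2)[OF h(1)]] by simp
  with d(2)[OF h'] show ?thesis by simp
qed

text \<open>
  Each visit of \<open>v\<close> uses one outgoing and one incoming half-edge at \<open>v\<close>, and together the visits use
  all four half-edges there.
\<close>

lemma two_visits:
  assumes c: "c \<in> C" "hs \<in> c" and h: "h \<in> half_edges_at F v" "he_edge h \<in> circuit_edges c"
  shows "card {m. m < length hs \<and> he_vertex (hs ! m) = v} = 2"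
proof -
  let ?n = "length hs"
  note rep = representative[OF c] and D = closed_trailD[OF representative(1)[OF c]]
  define N where "N = {m. m < ?n \<and> he_vertex (hs ! m) = v}"
  define M where "M = {m. m < ?n \<and> he_vertex (hs ! (Suc m mod ?n)) = v}"
  let ?A = "(\<lambda>m. hs ! m) ` N" and ?B = "(\<lambda>m. opposite F (hs ! m)) ` M"
  have fin: "finite N" "finite M" by (auto simp: N_def M_def)
  have "half_edges_at F v = ?A \<union> ?B"
  proof
    show "?A \<union> ?B \<subseteq> half_edges_at F v"
      using D(5,8) opposite_in_half_edges[OF G D(5)] by (auto simp: N_def M_def half_edges_at_def)
    show "half_edges_at F v \<subseteq> ?A \<union> ?B"
    proof
      fix x assume x: "x \<in> half_edges_at F v"
      then have xF: "x \<in> half_edges F" "he_vertex x = v" by (auto simp: half_edges_at_def)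
      have "he_edge x \<in> he_edge ` set hs"
        using edges_at_vertex_same_circuit[OF c(1) h x] rep(2) by simp
      from ex_passage[OF G rep(1) xF(1) this] obtain i where i: "i < ?n" "x \<in> passage F hs i" .
      then have "x = opposite F (hs ! i) \<or> x = hs ! (Suc i mod ?n)" by (auto simp: passage_def)
      then show "x \<in> ?A \<union> ?B"
      proof
        assume "x = opposite F (hs ! i)"
        with i xF D(8)[OF i(1)] have "i \<in> M" by (simp add: M_def)
        with \<open>x = opposite F (hs ! i)\<close> show ?thesis by blast
      next
        assume "x = hs ! (Suc i mod ?n)"
        moreover from this have "Suc i mod ?n \<in> N" using xF D(7)[OF i(1)] by (simp add: N_def)
        ultimately show ?thesis by blast
      qed
    qed
  qed
  moreover have "?A \<inter> ?B = {}"
  proof -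
    have "opposite F (hs ! m) \<notin> set hs" if "m \<in> M" for m
      by (rule opposite_not_on_trail[OF G rep(1)]) (use that in \<open>simp add: M_def\<close>)
    moreover have "hs ! m \<in> set hs" if "m \<in> N" for m using that by (simp add: N_def)
    ultimately have "hs ! m \<noteq> opposite F (hs ! m')" if "m \<in> N" "m' \<in> M" for m m'
      using that by metis
    then show ?thesis by blast
  qed
  ultimately have "card (half_edges_at F v) = card ?A + card ?B"
    using fin by (simp add: card_Un_disjoint)
  moreover have "card ?A = card N"
    by (rule card_image, rule inj_onI, rule D(9)) (auto simp: N_def)
  moreover have "card ?B = card M"
  proof (rule card_image, rule inj_onI)
    fix i j assume ij: "i \<in> M" "j \<in> M" "opposite F (hs ! i) = opposite F (hs ! j)"
    then have "i < ?n" "j < ?n" by (auto simp: M_def)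
    with ij(3) show "i = j"
      using D(9)[of i j] he_edge_opposite[OF G D(5)[of i]] he_edge_opposite[OF G D(5)[of j]] by simp
  qed
  moreover have "card M = card N"
  proof (rule bij_betw_same_card[of "\<lambda>m. Suc m mod ?n"], rule bij_betw_imageI)
    show "inj_on (\<lambda>m. Suc m mod ?n) M"
      by (rule inj_onI, rule cyclic_Suc_inject) (auto simp: M_def)
    show "(\<lambda>m. Suc m mod ?n) ` M = N"
    proof
      show "(\<lambda>m. Suc m mod ?n) ` M \<subseteq> N" using D(7) by (auto simp: M_def N_def)
      show "N \<subseteq> (\<lambda>m. Suc m mod ?n) ` M"
      proof
        fix j assume j: "j \<in> N"
        then have "j < ?n" by (simp add: N_def)
        then obtain i where "i < ?n" "Suc i mod ?n = j" by (rule ex_cyclic_pred)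
        with j show "j \<in> (\<lambda>m. Suc m mod ?n) ` M" by (intro image_eqI[of _ _ i]) (auto simp: M_def N_def)
      qed
    qed
  qed
  moreover have "v \<in> verts F" by (rule half_edges_atD(3)[OF h(1)])
  then have "card (half_edges_at F v) = 4" using four by (simp add: four_regular_def)
  ultimately show ?thesis unfolding N_def by simp
qed

lemma visit_positions:
  assumes c: "c \<in> C" "hs \<in> c" and h: "h \<in> half_edges_at F v" "he_edge h \<in> circuit_edges c"
  obtains i k where "i < k" "k < length hs" "{m. m < length hs \<and> he_vertex (hs ! m) = v} = {i, k}"
proof -
  from two_visits[OF assms] obtain p q
    where pq: "{m. m < length hs \<and> he_vertex (hs ! m) = v} = {p, q}" "p \<noteq> q"
    by (auto simp: card_2_iff)
  then have "{m. m < length hs \<and> he_vertex (hs ! m) = v} = {min p q, max p q}" "min p q < max p q"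
    by (auto simp: min_def max_def)
  moreover from this have "max p q < length hs" by blast
  ultimately show thesis by (intro that)
qed

text \<open>
  If a representative visits \<open>v\<close> at the positions \<open>i < k\<close>, then it leaves by \<open>hs ! i\<close> and \<open>hs ! k\<close>, and
  the arrival before \<open>hs ! k\<close> is by the opposite of \<open>hs ! (k - 1)\<close>. The arrival \<open>a\<close> before \<open>hs ! i\<close> may wrap
  around the end of the list, so it is left abstract. That \<open>a\<close> is not on the list identifies it as
  in-directed.
\<close>

lemma vertex_passages:
  assumes c: "c \<in> C" "hs \<in> c" and ik: "i < k" "k < length hs"
    and visits: "{m. m < length hs \<and> he_vertex (hs ! m) = v} = {i, k}"
  obtains a where
    "half_edges_at F v = {a, hs ! i, opposite F (hs ! (k - 1)), hs ! k}"
    "distinct [a, hs ! i, opposite F (hs ! (k - 1)), hs ! k]"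
    "transition F C v = {{a, hs ! i}, {opposite F (hs ! (k - 1)), hs ! k}}"
    "a \<notin> set hs"
proof -
  let ?n = "length hs"
  note rep = representative[OF c] and D = closed_trailD[OF representative(1)[OF c]]
  have iv: "he_vertex (hs ! i) = v" and kv: "he_vertex (hs ! k) = v" using visits by blast+
  have "i < ?n" using ik by simp
  then have h: "hs ! i \<in> half_edges_at F v" "he_edge (hs ! i) \<in> circuit_edges c"
    using D(5)[of i] iv rep(2) by (simp_all add: half_edges_at_def)
  from \<open>i < ?n\<close> obtain m where m: "m < ?n" "Suc m mod ?n = i" by (rule ex_cyclic_pred)
  define a where "a = opposite F (hs ! m)"
  have k1: "k - 1 < ?n" "Suc (k - 1) mod ?n = k" using ik by auto
  have pm: "passage F hs m = {a, hs ! i}" using m by (simp add: passage_def a_def)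
  have pk: "passage F hs (k - 1) = {opposite F (hs ! (k - 1)), hs ! k}" using k1 by (simp add: passage_def)
  have trans: "transition F C v = {{a, hs ! i}, {opposite F (hs ! (k - 1)), hs ! k}}"
  proof
    show "{{a, hs ! i}, {opposite F (hs ! (k - 1)), hs ! k}} \<subseteq> transition F C v"
      using passage_in_transition[OF c m(1)] passage_in_transition[OF c k1(1)] pm pk m k1 iv kv by simp
    show "transition F C v \<subseteq> {{a, hs ! i}, {opposite F (hs ! (k - 1)), hs ! k}}"
    proof
      fix t assume t: "t \<in> transition F C v"
      have "t \<noteq> {}" using card_transition[OF t] by auto
      then obtain x where x: "x \<in> t" by blast
      have "he_edge x \<in> circuit_edges c"
        using edges_at_vertex_same_circuit[OF c(1) h] transition_subset[OF t] x by blast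
      from transition_passage[OF t x this c] obtain j
        where j: "j < ?n" "t = passage F hs j" "he_vertex (hs ! (Suc j mod ?n)) = v" .
      then have "Suc j mod ?n \<in> {i, k}" using visits D(7)[OF j(1)] by blast
      then have "j = m \<or> j = k - 1"
        using cyclic_Suc_inject[OF j(1) m(1)] cyclic_Suc_inject[OF j(1) k1(1)] m k1 by auto
      with j pm pk show "t \<in> {{a, hs ! i}, {opposite F (hs ! (k - 1)), hs ! k}}" by auto
    qed
  qed
  have half: "half_edges_at F v = {a, hs ! i, opposite F (hs ! (k - 1)), hs ! k}"
    using partition_onD1[OF partition_on_transition[of v]] trans by auto
  have "v \<in> verts F" by (rule half_edges_atD(3)[OF h(1)])
  then have "card (half_edges_at F v) = 4" using four by (simp add: four_regular_def)
  then have "card {a, hs ! i, opposite F (hs ! (k - 1)), hs ! k} = 4" unfolding half .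
  then have "distinct [a, hs ! i, opposite F (hs ! (k - 1)), hs ! k]"
    by (intro card_distinct) simp
  moreover have "a \<notin> set hs" unfolding a_def using opposite_not_on_trail[OF G rep(1)] m(1) by simp
  ultimately show thesis by (rule that[OF half _ trans])
qed

text \<open>
  A labelling \<open>g\<close> of the edges that jumps by \<open>x v\<close> whenever a circuit of \<open>C\<close> passes \<open>v\<close>. Phrased with
  transitions, the condition does not mention representatives or directions.
\<close>

definition potential :: "('e \<Rightarrow> bit) \<Rightarrow> ('v \<Rightarrow> bit) \<Rightarrow> bool" where
  "potential g x \<longleftrightarrow> (\<forall>v\<in>verts F. \<forall>t\<in>transition F C v. \<forall>h\<in>t. \<forall>h'\<in>t.
     h \<noteq> h' \<longrightarrow> g (he_edge h) + g (he_edge h') = x v)"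

lemma potentialD:
  assumes "potential g x" "v \<in> verts F" "{h, h'} \<in> transition F C v" "h \<noteq> h'"
  shows "g (he_edge h) + g (he_edge h') = x v"
  using assms unfolding potential_def by blast

text \<open>
  The total jump around a circuit is zero, because each of its vertices is passed twice.
\<close>

lemma sum_along_circuit:
  assumes c: "c \<in> C" "hs \<in> c"
  shows "(\<Sum>j<length hs. x (he_vertex (hs ! j)) :: bit) = 0"
proof -
  let ?n = "length hs"
  note rep = representative[OF c] and D = closed_trailD[OF representative(1)[OF c]]
  have "(\<Sum>j<?n. x (he_vertex (hs ! j))) =
      (\<Sum>w\<in>verts F. \<Sum>j\<in>{j \<in> {..<?n}. he_vertex (hs ! j) = w}. x (he_vertex (hs ! j)))"
  proof (rule sum.group[symmetric])
    show "finite (verts F)" using G by (simp add: finite_graph_def)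
    show "(\<lambda>j. he_vertex (hs ! j)) ` {..<?n} \<subseteq> verts F"
      by (rule image_subsetI, rule he_vertex_in_verts, rule D(5)) simp
  qed simp
  also have "\<dots> = 0"
  proof (rule sum.neutral, rule ballI)
    fix w
    show "(\<Sum>j\<in>{j \<in> {..<?n}. he_vertex (hs ! j) = w}. x (he_vertex (hs ! j))) = 0"
    proof (cases "{j \<in> {..<?n}. he_vertex (hs ! j) = w} = {}")
      case False
      then obtain j where j: "j < ?n" "he_vertex (hs ! j) = w" by blast
      have "card {j \<in> {..<?n}. he_vertex (hs ! j) = w} = 2"
        using two_visits[OF c, of "hs ! j" w] j D(5)[OF j(1)] rep(2) by (simp add: half_edges_at_def)
      then show ?thesis by simp
    qed (simp only: sum.empty)
  qed
  finally show ?thesis .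
qed

text \<open>
  Take partial sums of \<open>x\<close> along a representative of each circuit. The jump where the list wraps
  around is correct because the total jump is zero.
\<close>

lemma ex_potential: "\<exists>g. potential g x"
proof -
  have "\<exists>hs. c \<in> C \<longrightarrow> hs \<in> c" for c using ex_representative by blast
  then obtain r where r: "\<And>c. c \<in> C \<Longrightarrow> r c \<in> c" by metis
  define index where "index e = (THE i. i < length (r (circuit_through e)) \<and>
      he_edge (r (circuit_through e) ! i) = e)" for e
  define g where "g e = (\<Sum>j<Suc (index e). x (he_vertex (r (circuit_through e) ! j)))" for e
  have g_nth: "g (he_edge (r c ! i)) = (\<Sum>j<Suc i. x (he_vertex (r c ! j)))"
    if c: "c \<in> C" and i: "i < length (r c)" for c i
  proof -
    note rep = representative[OF c r[OF c]]
    have "circuit_through (he_edge (r c ! i)) = c"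
      using circuit_through_eq[OF c] rep(2) i by simp
    moreover have "(THE j. j < length (r c) \<and> he_edge (r c ! j) = he_edge (r c ! i)) = i"
      using i closed_trailD(9)[OF rep(1)] by (intro the_equality) auto
    ultimately show ?thesis by (simp add: g_def index_def)
  qed
  have g_step: "g (he_edge (r c ! i)) + g (he_edge (r c ! (Suc i mod length (r c)))) =
      x (he_vertex (r c ! (Suc i mod length (r c))))"
    if c: "c \<in> C" and i: "i < length (r c)" for c i
  proof (cases "Suc i = length (r c)")
    case True
    have "0 < length (r c)" using i by linarith
    with True sum_along_circuit[OF c r[OF c], of x] g_nth[OF c i] g_nth[OF c, of 0]
    show ?thesis by simp
  next
    case False
    with i have "Suc i < length (r c)" by simp
    with g_nth[OF c i] g_nth[OF c this] show ?thesis by (simp flip: add.assoc)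
  qed
  have "g (he_edge h) + g (he_edge h') = x v"
    if v: "v \<in> verts F" and t: "t \<in> transition F C v" "h \<in> t" "h' \<in> t" "h \<noteq> h'" for v t h h'
  proof -
    have "h \<in> half_edges F" using transition_subset[OF t(1)] t(2) by (auto simp: half_edges_at_def)
    note c = circuit_through[OF this]
    let ?hs = "r (circuit_through (he_edge h))"
    obtain i where i: "i < length ?hs" "t = passage F ?hs i"
      "he_vertex (?hs ! (Suc i mod length ?hs)) = v"
      by (rule transition_passage[OF t(1,2) c(2,1) r[OF c(1)]])
    have "{h, h'} = {opposite F (?hs ! i), ?hs ! (Suc i mod length ?hs)}"
      using t(2-4) i(2) by (auto simp: passage_def)
    then have "g (he_edge h) + g (he_edge h') =
        g (he_edge (opposite F (?hs ! i))) + g (he_edge (?hs ! (Suc i mod length ?hs)))"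
      by (auto simp: doubleton_eq_iff add.commute)
    also have "\<dots> = x v"
      using g_step[OF c(1) i(1)] i(3) he_edge_opposite[OF G]
        closed_trailD(5)[OF representative(1)[OF c(1) r[OF c(1)]] i(1)] by simp
    finally show ?thesis .
  qed
  then show ?thesis unfolding potential_def by blast
qed

lemma potential_along_trail:
  assumes g: "potential g x" and c: "c \<in> C" "hs \<in> c" and ij: "i \<le> j" "j < length hs"
  shows "g (he_edge (hs ! i)) + g (he_edge (hs ! j)) = (\<Sum>m\<in>{i<..j}. x (he_vertex (hs ! m)))"
  using ij
proof (induction j rule: dec_induct)
  case (step j)
  note rep = representative[OF c] and D = closed_trailD[OF representative(1)[OF c]]
  have j: "j < length hs" "Suc j mod length hs = Suc j" using step.prems by simp_all
  have "hs ! Suc j \<in> set hs" "opposite F (hs ! j) \<notin> set hs"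
    using step.prems opposite_not_on_trail[OF G rep(1)] by simp_all
  then have "g (he_edge (opposite F (hs ! j))) + g (he_edge (hs ! Suc j)) = x (he_vertex (hs ! Suc j))"
    using passage_in_transition[OF c j(1)] j he_vertex_in_verts[OF D(5)[OF step.prems]]
    by (intro potentialD[OF g]) (auto simp: passage_def)
  then have "g (he_edge (hs ! j)) + g (he_edge (hs ! Suc j)) = x (he_vertex (hs ! Suc j))"
    using he_edge_opposite[OF G D(5)[OF j(1)]] by simp
  moreover have "{i<..Suc j} = insert (Suc j) {i<..j}" using step.hyps by auto
  ultimately show ?case
    using step.IH[OF j(1)]
    by (cases "g (he_edge (hs ! i))"; cases "g (he_edge (hs ! j))"; cases "g (he_edge (hs ! Suc j))") auto
qed simp

lemma potential_between_visits:
  assumes g: "potential g x" and c: "c \<in> C" "hs \<in> c" and ik: "i < k" "k < length hs"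
  shows "g (he_edge (hs ! i)) + g (he_edge (opposite F (hs ! (k - 1)))) =
    (\<Sum>m\<in>{i<..<k}. x (he_vertex (hs ! m)))"
proof -
  have k1: "i \<le> k - 1" "k - 1 < length hs" using ik by simp_all
  have "{i<..k - 1} = {i<..<k}" using ik by auto
  with potential_along_trail[OF g c k1] show ?thesis
    using he_edge_opposite[OF G closed_trailD(5)[OF representative(1)[OF c] k1(2)]] by simp
qed

text \<open>
  The definition of interlacement asks for the order \<open>v w v w\<close>; a representative that shows \<open>w v w v\<close> can
  be rotated to start at its first \<open>v\<close>.
\<close>

lemma interlaced_of_rotated_pattern:
  assumes c: "c \<in> C" "hs \<in> c" and idx: "p < q" "q < r" "r < s" "s < length hs"
    and vertices: "he_vertex (hs ! p) = w" "he_vertex (hs ! q) = v"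
      "he_vertex (hs ! r) = w" "he_vertex (hs ! s) = v" and "v \<noteq> w"
  shows "interlaced C v w"
proof -
  let ?n = "length hs" and ?hs = "rotate q hs"
  have nth: "?hs ! (m - q) = hs ! m" if "q \<le> m" "m < ?n" for m
    using that by (subst nth_rotate) auto
  have nth_p: "?hs ! (p + ?n - q) = hs ! p"
  proof -
    have "p + ?n - q < ?n" using idx by simp
    then have "?hs ! (p + ?n - q) = hs ! ((q + (p + ?n - q)) mod ?n)" by (rule nth_rotate)
    also have "q + (p + ?n - q) = p + ?n" using idx by simp
    finally show ?thesis using idx by simp
  qed
  have "?hs \<in> c" by (rule representative(4)[OF c])
  moreover have "0 < r - q" "r - q < s - q" "s - q < p + ?n - q" "p + ?n - q < length ?hs"
    using idx by auto
  moreover have "he_vertex (?hs ! 0) = v" "he_vertex (?hs ! (r - q)) = w"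
    "he_vertex (?hs ! (s - q)) = v" "he_vertex (?hs ! (p + ?n - q)) = w"
    using nth[of q] nth[of r] nth[of s] nth_p idx vertices by auto
  ultimately show ?thesis unfolding interlaced_def using c(1) \<open>v \<noteq> w\<close> by blast
qed

lemma interlaced_sym:
  assumes "interlaced C v w"
  shows "interlaced C w v"
proof -
  from assms obtain c hs i j k l where "v \<noteq> w" "c \<in> C" "hs \<in> c" "i < j" "j < k" "k < l" "l < length hs"
    "he_vertex (hs ! i) = v" "he_vertex (hs ! j) = w" "he_vertex (hs ! k) = v" "he_vertex (hs ! l) = w"
    unfolding interlaced_def by blast
  then show ?thesis by (intro interlaced_of_rotated_pattern[of c hs i j k l]) auto
qed

text \<open>
  Interlacement may be witnessed by any list representing the circuit, while the right-hand side
  refers to a given one. For \<open>v \<noteq> w\<close>, a potential \<open>g\<close> for the indicator of \<open>w\<close> transfers the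
  information: it takes one value on each of the two pairs in the transition of \<open>C\<close> at \<open>v\<close>, and these values differ iff \<open>w\<close> occurs
  an odd number of times between the two visits of \<open>v\<close>. The former does not depend on the
  representative.
\<close>

lemma interlaced_iff_odd_between:
  assumes c: "c \<in> C" "hs \<in> c" and ik: "i < k" "k < length hs"
    and visits: "{m. m < length hs \<and> he_vertex (hs ! m) = v} = {i, k}"
  shows "interlaced C v w \<longleftrightarrow> odd (card {m \<in> {i<..<k}. he_vertex (hs ! m) = w})"
    (is "_ \<longleftrightarrow> odd (card ?N)")
proof (cases "v = w")
  case True
  have "he_vertex (hs ! m) \<noteq> v" if m: "m \<in> {i<..<k}" for m
  proof
    assume "he_vertex (hs ! m) = v"
    then have "m \<in> {i, k}" unfolding visits[symmetric] using m ik by simp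
    with m show False by simp
  qed
  then have "?N = {}" using True by blast
  then have "\<not> odd (card ?N)" by (simp only: card.empty even_zero not_not)
  moreover have "\<not> interlaced C v w" using True by (simp add: interlaced_def)
  ultimately show ?thesis by blast
next
  case False
  note rep = representative[OF c] and D = closed_trailD[OF representative(1)[OF c]]
  have iv: "he_vertex (hs ! i) = v" and kv: "he_vertex (hs ! k) = v" using visits by blast+
  let ?b = "hs ! i" and ?c = "opposite F (hs ! (k - 1))" and ?d = "hs ! k"
  show ?thesis
  proof
    assume "interlaced C v w"
    then obtain c' hs' i' j' k' l' where pat: "c' \<in> C" "hs' \<in> c'" "i' < j'" "j' < k'" "k' < l'"
      "l' < length hs'" "he_vertex (hs' ! i') = v" "he_vertex (hs' ! j') = w"
      "he_vertex (hs' ! k') = v" "he_vertex (hs' ! l') = w"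
      unfolding interlaced_def by blast
    let ?b' = "hs' ! i'" and ?c' = "opposite F (hs' ! (k' - 1))"
    define x :: "'v \<Rightarrow> bit" where "x u = of_bool (u = w)" for u
    obtain g where g: "potential g x" using ex_potential by blast
    note rep' = representative[OF pat(1,2)] and D' = closed_trailD[OF representative(1)[OF pat(1,2)]]
    have visit': "card {m. m < length hs' \<and> he_vertex (hs' ! m) = he_vertex (hs' ! n)} = 2"
      if "n < length hs'" for n
      using two_visits[OF pat(1,2), of "hs' ! n"] that D'(5)[OF that] rep'(2)
      by (simp add: half_edges_at_def)
    have pair: "{m. m < length hs' \<and> he_vertex (hs' ! m) = u} = {p, q}"
      if "p < q" "q < length hs'" "he_vertex (hs' ! p) = u" "he_vertex (hs' ! q) = u" for p q u
      using that visit'[of p] by (intro card_subset_eq[symmetric]) auto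
    have v': "{m. m < length hs' \<and> he_vertex (hs' ! m) = v} = {i', k'}"
      using pat by (intro pair) auto
    have w': "{m. m < length hs' \<and> he_vertex (hs' ! m) = w} = {j', l'}"
      using pat by (intro pair) auto
    have "{m \<in> {i'<..<k'}. he_vertex (hs' ! m) = w} = {j', l'} \<inter> {i'<..<k'}"
      unfolding w'[symmetric] using pat by auto
    also have "\<dots> = {j'}" using pat by auto
    finally have one: "{m \<in> {i'<..<k'}. he_vertex (hs' ! m) = w} = {j'}" .
    have sum_x: "(\<Sum>m\<in>{p<..<q}. x (he_vertex (ys ! m))) =
        of_bool (odd (card {m \<in> {p<..<q}. he_vertex (ys ! m) = w}))" for p q ys
      by (simp add: x_def sum.If_cases of_bool_def Int_def of_nat_bit)
    obtain a where H: "half_edges_at F v = {a, ?b, ?c, ?d}" "distinct [a, ?b, ?c, ?d]"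
      "transition F C v = {{a, ?b}, {?c, ?d}}" "a \<notin> set hs"
      by (rule vertex_passages[OF c ik visits])
    have i'k': "i' < k'" "k' < length hs'" using pat by auto
    let ?d' = "hs' ! k'"
    obtain a' where H': "half_edges_at F v = {a', ?b', ?c', ?d'}" "distinct [a', ?b', ?c', ?d']"
      "transition F C v = {{a', ?b'}, {?c', ?d'}}" "a' \<notin> set hs'"
      by (rule vertex_passages[OF pat(1,2) i'k' v'])
    have between: "g (he_edge ?b) + g (he_edge ?c) = of_bool (odd (card ?N))"
      using potential_between_visits[OF g c ik] sum_x[of hs i k] by simp
    have between': "g (he_edge ?b') + g (he_edge ?c') = 1"
      using potential_between_visits[OF g pat(1,2) i'k'] sum_x[of hs' i' k'] one by simp
    \<comment> \<open>\<open>g\<close> does not jump at \<open>v\<close>, so only the pairs containing the half-edges matter\<close>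
    have vF: "v \<in> verts F" using he_vertex_in_verts[OF D(5)[of i]] ik iv by simp
    have "g (he_edge a) = g (he_edge ?b)" "g (he_edge ?c) = g (he_edge ?d)"
      using potentialD[OF g vF, of a ?b] potentialD[OF g vF, of ?c ?d] H(2,3) False
      by (simp_all add: x_def bit_add_eq_0_iff)
    moreover have "(?b' \<in> {a, ?b} \<and> ?c' \<in> {?c, ?d}) \<or> (?b' \<in> {?c, ?d} \<and> ?c' \<in> {a, ?b})"
    proof -
      have "{{a', ?b'}, {?c', ?d'}} = {{a, ?b}, {?c, ?d}}" using H(3) H'(3) by simp
      then have "({a', ?b'} = {a, ?b} \<and> {?c', ?d'} = {?c, ?d}) \<or>
          ({a', ?b'} = {?c, ?d} \<and> {?c', ?d'} = {a, ?b})"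
        by (simp only: doubleton_eq_iff)
      then show ?thesis by blast
    qed
    ultimately have "g (he_edge ?b') + g (he_edge ?c') = g (he_edge ?b) + g (he_edge ?c)"
      by (elim disjE conjE insertE emptyE) (simp_all add: add.commute)
    then show "odd (card ?N)" using between between' by (simp add: of_bool_def split: if_splits)
  next
    assume odd: "odd (card ?N)"
    have "?N \<noteq> {}" using odd by (metis card.empty even_zero)
    then obtain j where j: "i < j" "j < k" "he_vertex (hs ! j) = w" by auto
    let ?W = "{m. m < length hs \<and> he_vertex (hs ! m) = w}"
    have W2: "card ?W = 2"
      using two_visits[OF c, of "hs ! j" w] j ik D(5)[of j] rep(2) by (simp add: half_edges_at_def)
    have NW: "?N \<subseteq> ?W" using ik by auto
    have "\<not> ?W \<subseteq> ?N"
    proof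
      assume "?W \<subseteq> ?N"
      with NW have "?N = ?W" by (rule subset_antisym)
      then have "card ?N = 2" using W2 by (simp only:)
      with odd show False by (simp only: dvd_refl not_True_eq_False)
    qed
    then obtain l where "l \<in> ?W - ?N" by blast
    then have l: "l < length hs" "he_vertex (hs ! l) = w" "l \<notin> {i<..<k}" by blast+
    have "l \<noteq> i" "l \<noteq> k" using iv kv l(2) False by metis+
    with l(3) have "k < l \<or> l < i" by (auto simp: not_less)
    then consider "k < l" | "l < i" by blast
    then show "interlaced C v w"
    proof cases
      case 1
      then show ?thesis unfolding interlaced_def
        using c j l iv kv False
        by (intro conjI bexI[of _ c] bexI[of _ hs] exI[of _ i] exI[of _ j] exI[of _ k] exI[of _ l])
    next
      case 2
      with c j l ik iv kv False show ?thesis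
        by (intro interlaced_of_rotated_pattern[of c hs l i j k]) auto
    qed
  qed
qed

text \<open>
  Between the two visits of \<open>v\<close> a vertex occurs zero, one or two times, and exactly those that occur
  once contribute to the change of the potential.
\<close>

lemma potential_interlacement_sum:
  assumes g: "potential g x" and c: "c \<in> C" "hs \<in> c" and ik: "i < k" "k < length hs"
    and visits: "{m. m < length hs \<and> he_vertex (hs ! m) = v} = {i, k}"
  shows "g (he_edge (hs ! i)) + g (he_edge (opposite F (hs ! (k - 1)))) =
    (\<Sum>w\<in>verts F. of_bool (interlaced C v w) * x w)"
proof -
  note D = closed_trailD[OF representative(1)[OF c]]
  have "(\<Sum>m\<in>{i<..<k}. x (he_vertex (hs ! m))) =
      (\<Sum>w\<in>verts F. \<Sum>m\<in>{m \<in> {i<..<k}. he_vertex (hs ! m) = w}. x (he_vertex (hs ! m)))"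
  proof (rule sum.group[symmetric])
    show "finite (verts F)" using G by (simp add: finite_graph_def)
    show "(\<lambda>m. he_vertex (hs ! m)) ` {i<..<k} \<subseteq> verts F"
      by (rule image_subsetI, rule he_vertex_in_verts, rule D(5)) (use ik in simp)
  qed simp
  also have "\<dots> = (\<Sum>w\<in>verts F. of_bool (interlaced C v w) * x w)"
    by (rule sum.cong) (simp_all add: interlaced_iff_odd_between[OF c ik visits] of_nat_bit)
  finally show ?thesis using potential_between_visits[OF g c ik] by simp
qed

end

section \<open>The null space of the relative interlacement graph\<close>

locale compatible_partition = C: euler_graph F C + P: partitioned_graph F P
  for F :: "('v, 'e) graph" and C P :: "('v, 'e) circuit set" +
  assumes compat: "compatible F C P"
begin

lemma transition_C_neq_P: "v \<in> verts F \<Longrightarrow> transition F C v \<noteq> transition F P v"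
  using compat by (simp add: compatible_def)

lemma relative_interlacement_adjacent:
  assumes "v \<in> verts F" "w \<in> verts F"
  shows "adjacency_matrix (relative_interlacement_graph F C P) v w =
    of_bool (interlaced C v w \<or> (v = w \<and> type_psi F C P v))"
proof -
  let ?R = "relative_interlacement_graph F C P"
  have "{v \<in> verts (interlacement_graph F C). \<not> type_phi F C P v} = verts F"
    using transition_C_neq_P by (auto simp: interlacement_graph_def type_phi_def)
  then have edges: "edges ?R = edges_within (interlacement_graph F C) (verts F) \<union>
      {{v} | v. v \<in> verts F \<and> type_psi F C P v}" and ends: "ends ?R = (\<lambda>e. e)"
    by (simp_all add: relative_interlacement_graph_def Let_def)
  have "adjacent ?R v w \<longleftrightarrow> {v, w} \<in> edges ?R" by (auto simp: adjacent_def ends)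
  also have "\<dots> \<longleftrightarrow> interlaced C v w \<or> (v = w \<and> type_psi F C P v)"
  proof -
    have "{v, w} \<in> edges_within (interlacement_graph F C) (verts F) \<longleftrightarrow> interlaced C v w"
      using assms C.interlaced_sym
      by (auto simp: edges_within_def interlacement_graph_def doubleton_eq_iff)
    moreover have "{v, w} \<in> {{v} | v. v \<in> verts F \<and> type_psi F C P v} \<longleftrightarrow> v = w \<and> type_psi F C P v"
      using assms by (auto simp: doubleton_eq_iff)
    ultimately show ?thesis unfolding edges by blast
  qed
  finally show ?thesis by (simp add: adjacency_matrix_def)
qed

lemma verts_relative_interlacement: "verts (relative_interlacement_graph F C P) = verts F"
  using transition_C_neq_P
  by (auto simp: relative_interlacement_graph_def Let_def interlacement_graph_def type_phi_def)

text \<open>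
  The half-edges \<open>b\<close> and \<open>d\<close> are the out-directed ones at \<open>v\<close>. The representatives of other circuits of
  \<open>C\<close> contribute nothing at \<open>v\<close>, since they have no edge there.
\<close>

lemma type_psi_passages:
  assumes r: "\<And>c. c \<in> C \<Longrightarrow> r c \<in> c" and c: "c \<in> C"
    and half: "half_edges_at F v = {a, b, c', d}" and dist: "distinct [a, b, c', d]"
    and on: "b \<in> set (r c)" "d \<in> set (r c)" "a \<notin> set (r c)" "c' \<notin> set (r c)"
  shows "half_edges_at F v - (\<Union>c\<in>C. set (r c)) = {a, c'}"
    "half_edges_at F v \<inter> (\<Union>c\<in>C. set (r c)) = {b, d}"
proof -
  have only: "x \<in> set (r c)" if x: "x \<in> half_edges_at F v" "e \<in> C" "x \<in> set (r e)" for x e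
  proof -
    have "he_edge b \<in> circuit_edges c" using C.representative(2)[OF c r[OF c]] on(1) by simp
    moreover have "b \<in> half_edges_at F v" using half by simp
    ultimately have "he_edge x \<in> circuit_edges c"
      using C.edges_at_vertex_same_circuit[OF c] x(1) by blast
    moreover have "he_edge x \<in> circuit_edges e"
      using C.representative(2)[OF x(2) r[OF x(2)]] x(3) by simp
    ultimately have "e = c" using C.circuit_through_eq c x(2) by metis
    with x show ?thesis by simp
  qed
  have "a \<notin> (\<Union>c\<in>C. set (r c))" "c' \<notin> (\<Union>c\<in>C. set (r c))"
    using only[of a] only[of c'] on half by blast+
  moreover have "b \<in> (\<Union>c\<in>C. set (r c))" "d \<in> (\<Union>c\<in>C. set (r c))" using on c by blast+
  ultimately show "half_edges_at F v - (\<Union>c\<in>C. set (r c)) = {a, c'}"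
    "half_edges_at F v \<inter> (\<Union>c\<in>C. set (r c)) = {b, d}"
    unfolding half by auto
qed

text \<open>
  Here \<open>a\<close> and \<open>opposite F (hs ! (k - 1))\<close> are in-directed at \<open>v\<close>, and \<open>hs ! i\<close> and \<open>hs ! k\<close> are the
  out-directed half-edges that follow them on \<open>C\<close>. By compatibility the transition of \<open>P\<close> is of type
  \<open>\<psi>\<close> or of type \<open>\<chi>\<close>. The representative \<open>hs\<close> is taken from the orientation that witnesses type \<open>\<psi>\<close>, if
  there is one, which avoids showing that the type is independent of the orientation.
\<close>

lemma typed_passages:
  assumes v: "v \<in> verts F"
  obtains c hs i k a where "c \<in> C" "hs \<in> c" "i < k" "k < length hs"
    "{m. m < length hs \<and> he_vertex (hs ! m) = v} = {i, k}"
    "distinct [a, hs ! i, opposite F (hs ! (k - 1)), hs ! k]"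
    "transition F C v = {{a, hs ! i}, {opposite F (hs ! (k - 1)), hs ! k}}"
    "transition F P v = (if type_psi F C P v
       then {{a, opposite F (hs ! (k - 1))}, {hs ! i, hs ! k}}
       else {{a, hs ! k}, {hs ! i, opposite F (hs ! (k - 1))}})"
proof -
  have "\<exists>r. (\<forall>c\<in>C. r c \<in> c) \<and> (type_psi F C P v \<longrightarrow> transition F P v =
      {half_edges_at F v - (\<Union>c\<in>C. set (r c)), half_edges_at F v \<inter> (\<Union>c\<in>C. set (r c))})"
  proof (cases "type_psi F C P v")
    case True
    then show ?thesis by (auto simp: type_psi_def orientation_def)
  next
    case False
    have "\<exists>hs. c \<in> C \<longrightarrow> hs \<in> c" for c using C.ex_representative by blast
    then have "\<exists>r. \<forall>c\<in>C. r c \<in> c" by metis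
    with False show ?thesis by blast
  qed
  then obtain r where reps: "\<forall>c\<in>C. r c \<in> c" and psi: "type_psi F C P v \<longrightarrow> transition F P v =
      {half_edges_at F v - (\<Union>c\<in>C. set (r c)), half_edges_at F v \<inter> (\<Union>c\<in>C. set (r c))}"
    by (elim exE conjE) (rule that)
  have r: "r c \<in> c" if "c \<in> C" for c using reps that by blast
  obtain c where c: "c \<in> C" "\<And>h. h \<in> half_edges_at F v \<Longrightarrow> he_edge h \<in> circuit_edges c"
    using C.circuit_at_vertex[OF v] by blast
  have "card (half_edges_at F v) = 4" using C.four v by (simp add: four_regular_def)
  then have "half_edges_at F v \<noteq> {}" by auto
  then obtain h where h: "h \<in> half_edges_at F v" by blast
  let ?hs = "r c"
  note rc = r[OF c(1)]
  note rep = C.representative[OF c(1) rc]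
  obtain i k where ik: "i < k" "k < length ?hs"
    "{m. m < length ?hs \<and> he_vertex (?hs ! m) = v} = {i, k}"
    by (rule C.visit_positions[OF c(1) rc h c(2)[OF h]])
  let ?b = "?hs ! i" and ?c = "opposite F (?hs ! (k - 1))" and ?d = "?hs ! k"
  obtain a where a: "half_edges_at F v = {a, ?b, ?c, ?d}" "distinct [a, ?b, ?c, ?d]"
    "transition F C v = {{a, ?b}, {?c, ?d}}" "a \<notin> set ?hs"
    by (rule C.vertex_passages[OF c(1) rc ik])
  have on: "?b \<in> set ?hs" "?d \<in> set ?hs" "?c \<notin> set ?hs"
    using ik opposite_not_on_trail[OF C.G rep(1)] by simp_all
  note D = type_psi_passages[of r, OF r c(1) a(1,2) on(1,2) a(4) on(3)]
  have P_cases: "transition F P v \<in> {{{a, ?b}, {?c, ?d}}, {{a, ?c}, {?b, ?d}}, {{a, ?d}, {?b, ?c}}}"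
    by (rule P.transition_of_four[OF a(1,2)])
  have "transition F P v = (if type_psi F C P v then {{a, ?c}, {?b, ?d}} else {{a, ?d}, {?b, ?c}})"
  proof (cases "type_psi F C P v")
    case True
    with psi D show ?thesis by simp
  next
    case False
    have "transition F P v \<noteq> {{a, ?c}, {?b, ?d}}"
    proof
      assume "transition F P v = {{a, ?c}, {?b, ?d}}"
      then have "type_psi F C P v" unfolding type_psi_def orientation_def
        using r D by (intro exI[of _ "\<Union>c\<in>C. set (r c)"] conjI exI[of _ r]) simp_all
      with False show False by simp
    qed
    with P_cases transition_C_neq_P[OF v] a(3) False show ?thesis by auto
  qed
  with c(1) rc ik a(2,3) show thesis by (rule that)
qed

lemma transition_pairs:
  assumes v: "v \<in> verts F"
  obtains a b c d where "half_edges_at F v = {a, b, c, d}" "a \<noteq> b"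
    "transition F C v = {{a, b}, {c, d}}"
    "transition F P v = {{a, c}, {b, d}} \<or> transition F P v = {{a, d}, {b, c}}"
proof -
  obtain c hs i k a where Q: "c \<in> C" "hs \<in> c" "i < k" "k < length hs"
    "{m. m < length hs \<and> he_vertex (hs ! m) = v} = {i, k}"
    "distinct [a, hs ! i, opposite F (hs ! (k - 1)), hs ! k]"
    "transition F C v = {{a, hs ! i}, {opposite F (hs ! (k - 1)), hs ! k}}"
    "transition F P v = (if type_psi F C P v
       then {{a, opposite F (hs ! (k - 1))}, {hs ! i, hs ! k}}
       else {{a, hs ! k}, {hs ! i, opposite F (hs ! (k - 1))}})"
    by (rule typed_passages[OF v])
  show thesis
  proof (rule that[OF _ _ Q(7)])
    show "half_edges_at F v = {a, hs ! i, opposite F (hs ! (k - 1)), hs ! k}"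
      using partition_onD1[OF C.partition_on_transition[of v]] Q(7) by auto
    show "a \<noteq> hs ! i" using Q(6) by simp
    show "transition F P v = {{a, opposite F (hs ! (k - 1))}, {hs ! i, hs ! k}} \<or>
        transition F P v = {{a, hs ! k}, {hs ! i, opposite F (hs ! (k - 1))}}"
      unfolding Q(8) by (cases "type_psi F C P v") (simp_all only: if_True if_False simp_thms)
  qed
qed

text \<open>
  Write \<open>a, b, c, d\<close> for the half-edges at \<open>v\<close> in the order in which \<open>C\<close> meets them, starting with an
  arrival. The entries of row \<open>v\<close> off the diagonal give the change \<open>g b + g c\<close> of the potential between
  the two visits of \<open>v\<close>. For type \<open>\<chi>\<close>, which pairs \<open>a\<close> with \<open>d\<close> and \<open>b\<close> with \<open>c\<close>, this is the obstruction to
  constancy. For type \<open>\<psi>\<close>, which pairs \<open>a\<close> with \<open>c\<close> and \<open>b\<close> with \<open>d\<close>, the loop at \<open>v\<close> adds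
  \<open>x v = g a + g b\<close> and leaves \<open>g a + g c\<close>.
\<close>

lemma adjacency_row_iff_constant_on_transition:
  assumes g: "C.potential g x" and v: "v \<in> verts F"
  shows "(\<Sum>w\<in>verts F. x w * adjacency_matrix (relative_interlacement_graph F C P) v w) = 0 \<longleftrightarrow>
    (\<forall>t\<in>transition F P v. \<forall>h\<in>t. \<forall>h'\<in>t. g (he_edge h) = g (he_edge h'))"
proof -
  obtain c hs i k a where P: "c \<in> C" "hs \<in> c" "i < k" "k < length hs"
    "{m. m < length hs \<and> he_vertex (hs ! m) = v} = {i, k}"
    "distinct [a, hs ! i, opposite F (hs ! (k - 1)), hs ! k]"
    "transition F C v = {{a, hs ! i}, {opposite F (hs ! (k - 1)), hs ! k}}"
    "transition F P v = (if type_psi F C P v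
       then {{a, opposite F (hs ! (k - 1))}, {hs ! i, hs ! k}}
       else {{a, hs ! k}, {hs ! i, opposite F (hs ! (k - 1))}})"
    by (rule typed_passages[OF v])
  let ?g = "\<lambda>h. g (he_edge h)"
  let ?b = "hs ! i" and ?c = "opposite F (hs ! (k - 1))" and ?d = "hs ! k"
  have sum: "(\<Sum>w\<in>verts F. x w * adjacency_matrix (relative_interlacement_graph F C P) v w) =
      ?g ?b + ?g ?c + of_bool (type_psi F C P v) * x v"
  proof -
    have "(\<Sum>w\<in>verts F. x w * adjacency_matrix (relative_interlacement_graph F C P) v w) =
        (\<Sum>w\<in>verts F. of_bool (interlaced C v w) * x w +
          (if w = v then of_bool (type_psi F C P v) * x v else 0))"
    proof (rule sum.cong[OF refl])
      fix w assume "w \<in> verts F"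
      moreover have "\<not> interlaced C v v" by (simp add: interlaced_def)
      ultimately show "x w * adjacency_matrix (relative_interlacement_graph F C P) v w =
          of_bool (interlaced C v w) * x w + (if w = v then of_bool (type_psi F C P v) * x v else 0)"
        using relative_interlacement_adjacent[OF v] by auto
    qed
    also have "\<dots> = (\<Sum>w\<in>verts F. of_bool (interlaced C v w) * x w) + of_bool (type_psi F C P v) * x v"
      using C.G v by (simp add: sum.distrib finite_graph_def)
    also have "(\<Sum>w\<in>verts F. of_bool (interlaced C v w) * x w) = ?g ?b + ?g ?c"
      by (rule C.potential_interlacement_sum[OF g P(1-5), symmetric])
    finally show ?thesis .
  qed
  have jump: "?g a + ?g ?b = x v" "?g ?c + ?g ?d = x v"
    using C.potentialD[OF g v, of a ?b] C.potentialD[OF g v, of ?c ?d] P(6,7) by simp_all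
  show ?thesis
  proof (cases "type_psi F C P v")
    case True
    have "(\<forall>t\<in>transition F P v. \<forall>h\<in>t. \<forall>h'\<in>t. ?g h = ?g h') \<longleftrightarrow> ?g a = ?g ?c \<and> ?g ?b = ?g ?d"
      using P(8) True by auto
    moreover have "?g ?b + ?g ?c + x v = 0 \<longleftrightarrow> ?g a = ?g ?c \<and> ?g ?b = ?g ?d"
      using jump by (cases "?g a"; cases "?g ?b"; cases "?g ?c"; cases "?g ?d") auto
    ultimately show ?thesis using sum True by simp
  next
    case False
    have "(\<forall>t\<in>transition F P v. \<forall>h\<in>t. \<forall>h'\<in>t. ?g h = ?g h') \<longleftrightarrow> ?g a = ?g ?d \<and> ?g ?b = ?g ?c"
      using P(8) False by auto
    moreover have "?g ?b + ?g ?c = 0 \<longleftrightarrow> ?g a = ?g ?d \<and> ?g ?b = ?g ?c"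
      using jump by (cases "?g a"; cases "?g ?b"; cases "?g ?c"; cases "?g ?d") auto
    ultimately show ?thesis using sum False by simp
  qed
qed

text \<open>
  Two half-edges paired by \<open>C\<close> at \<open>v\<close> lie in different pairs of \<open>P\<close>, so they meet every circuit of \<open>P\<close>
  at \<open>v\<close>.
\<close>

lemma touch_graph_ends_pair:
  assumes v: "v \<in> verts F" and t: "t \<in> transition F C v" "h \<in> t" "h' \<in> t" "h \<noteq> h'"
  shows "ends (touch_graph F P) v =
    {P.circuit_through (he_edge h), P.circuit_through (he_edge h')}"
proof -
  let ?f = "\<lambda>h. P.circuit_through (he_edge h)"
  obtain a b c d where Q: "half_edges_at F v = {a, b, c, d}" "a \<noteq> b"
    "transition F C v = {{a, b}, {c, d}}"
    "transition F P v = {{a, c}, {b, d}} \<or> transition F P v = {{a, d}, {b, c}}"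
    by (rule transition_pairs[OF v])
  have same: "?f p = ?f q" if "{p, q} \<in> transition F P v" for p q
    by (rule P.transition_half_edge_circuit[OF that]) simp_all
  have ab_cd: "{?f a, ?f b} = {?f c, ?f d}"
    using Q(4)
  proof
    assume "transition F P v = {{a, c}, {b, d}}"
    then have "?f a = ?f c" "?f b = ?f d" using same[of a c] same[of b d] by simp_all
    then show ?thesis by simp
  next
    assume "transition F P v = {{a, d}, {b, c}}"
    then have "?f a = ?f d" "?f b = ?f c" using same[of a d] same[of b c] by simp_all
    then show ?thesis by (simp add: insert_commute)
  qed
  have "t = {h, h'}" using C.card_transition[OF t(1)] t(2-4) by (auto simp: card_2_iff)
  then have "{h, h'} = {a, b} \<or> {h, h'} = {c, d}" using t(1) Q(3) by simp
  then have "{?f h, ?f h'} = {?f a, ?f b} \<or> {?f h, ?f h'} = {?f c, ?f d}"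
    by (auto simp: doubleton_eq_iff)
  moreover have "ends (touch_graph F P) v = {?f a, ?f b} \<union> {?f c, ?f d}"
    unfolding P.touch_graph_ends Q(1) by auto
  ultimately show ?thesis using ab_cd by auto
qed

lemma finite_touch_graph: "finite_graph (touch_graph F P)"
proof -
  have "ends (touch_graph F P) v \<subseteq> P \<and> card (ends (touch_graph F P) v) \<in> {1, 2}"
    if v: "v \<in> verts F" for v
  proof
    show "ends (touch_graph F P) v \<subseteq> P" by (auto simp: touch_graph_def)
    obtain a b c d where Q: "half_edges_at F v = {a, b, c, d}" and neq: "a \<noteq> b"
      and C_trans: "transition F C v = {{a, b}, {c, d}}"
      and "transition F P v = {{a, c}, {b, d}} \<or> transition F P v = {{a, d}, {b, c}}"
      by (rule transition_pairs[OF v])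
    from C_trans have t: "{a, b} \<in> transition F C v" by simp
    from touch_graph_ends_pair[OF v t _ _ neq]
    show "card (ends (touch_graph F P) v) \<in> {1, 2}" by (simp add: card_insert_if)
  qed
  moreover have "finite (verts F)" using C.G by (simp add: finite_graph_def)
  ultimately show ?thesis
    using P.finite_circuits by (simp add: finite_graph_def touch_graph_def)
qed

text \<open>
  A vector \<open>x\<close> in the null space has a potential that is constant on the circuits of \<open>P\<close>, say with value
  \<open>f c\<close> on \<open>c\<close>; the jump \<open>x v\<close> of the potential is then the difference of \<open>f\<close> at the two circuits of \<open>P\<close>
  at \<open>v\<close>. Conversely, labelling each edge with the value of \<open>f\<close> at its circuit of \<open>P\<close> gives a potential
  for the coboundary of \<open>f\<close>.
\<close>

lemma null_space_eq_coboundaries: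
  "x \<in> null_space (verts F) (adjacency_matrix (relative_interlacement_graph F C P)) \<longleftrightarrow>
    (\<exists>f. \<forall>v\<in>verts F. x v = coboundary (touch_graph F P) f v)"
    (is "x \<in> ?N \<longleftrightarrow> _")
proof
  assume x: "x \<in> ?N"
  obtain g where g: "C.potential g x" using C.ex_potential by blast
  have const: "g (he_edge h) = g (he_edge h')" if t: "t \<in> transition F P v" "h \<in> t" "h' \<in> t" for v t h h'
  proof -
    have "h \<in> half_edges_at F v" using P.transition_subset[OF t(1)] t(2) by blast
    then have v: "v \<in> verts F" by (rule P.half_edges_atD(3))
    from x v have "(\<Sum>w\<in>verts F. x w *
        adjacency_matrix (relative_interlacement_graph F C P) v w) = 0"
      by (simp add: null_space_def)
    with t show ?thesis unfolding adjacency_row_iff_constant_on_transition[OF g v] by blast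
  qed
  define f where "f c = g (SOME e. e \<in> circuit_edges c)" for c :: "('v, 'e) circuit"
  have f: "f (P.circuit_through (he_edge h)) = g (he_edge h)" if "h \<in> half_edges F" for h
  proof -
    note c = P.circuit_through[OF that]
    from c(2) have some: "(SOME e. e \<in> circuit_edges (P.circuit_through (he_edge h))) \<in>
        circuit_edges (P.circuit_through (he_edge h))" by (rule someI)
    show ?thesis unfolding f_def by (rule P.constant_on_circuits[of g, OF const c(1) some c(2)])
  qed
  have "x v = coboundary (touch_graph F P) f v" if v: "v \<in> verts F" for v
  proof -
    obtain a b c d where Q: "half_edges_at F v = {a, b, c, d}" and neq: "a \<noteq> b"
      and C_trans: "transition F C v = {{a, b}, {c, d}}"
      and "transition F P v = {{a, c}, {b, d}} \<or> transition F P v = {{a, d}, {b, c}}"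
      by (rule transition_pairs[OF v])
    from C_trans have t: "{a, b} \<in> transition F C v" by simp
    have "a \<in> half_edges_at F v" "b \<in> half_edges_at F v" using Q by simp_all
    then have "a \<in> half_edges F" "b \<in> half_edges F" using C.half_edges_atD(1) by blast+
    then show ?thesis
      using coboundary_ends[OF touch_graph_ends_pair[OF v t _ _ neq], of f]
        C.potentialD[OF g v t neq] f by simp
  qed
  then show "\<exists>f. \<forall>v\<in>verts F. x v = coboundary (touch_graph F P) f v" by blast
next
  assume "\<exists>f. \<forall>v\<in>verts F. x v = coboundary (touch_graph F P) f v"
  then obtain f where f: "\<And>v. v \<in> verts F \<Longrightarrow> x v = coboundary (touch_graph F P) f v" by blast
  define g where "g e = f (P.circuit_through e)" for e
  have pot: "C.potential g x"
    unfolding C.potential_def g_def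
  proof (intro ballI impI)
    fix v t h h' assume v: "v \<in> verts F" and t: "t \<in> transition F C v" "h \<in> t" "h' \<in> t" "h \<noteq> h'"
    show "f (P.circuit_through (he_edge h)) + f (P.circuit_through (he_edge h')) = x v"
      using coboundary_ends[OF touch_graph_ends_pair[OF v t], of f] f[OF v] by simp
  qed
  have const: "g (he_edge h) = g (he_edge h')" if "t \<in> transition F P v" "h \<in> t" "h' \<in> t" for t v h h'
    unfolding g_def using P.transition_half_edge_circuit[OF that] by simp
  have "(\<Sum>w\<in>verts F. x w * adjacency_matrix (relative_interlacement_graph F C P) v w) = 0"
    if v: "v \<in> verts F" for v
    unfolding adjacency_row_iff_constant_on_transition[OF pot v] using const by blast
  then show "x \<in> ?N" by (simp add: null_space_def)
qed

lemma dual_adjacency_matroid_eq_polygon_matroid: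
  "dual (adjacency_matroid (relative_interlacement_graph F C P)) = polygon_matroid (touch_graph F P)"
proof -
  let ?R = "relative_interlacement_graph F C P" and ?T = "touch_graph F P"
  have orth: "(\<forall>x\<in>null_space (verts F) (adjacency_matrix ?R). (\<Sum>v\<in>T. x v) = 0) \<longleftrightarrow>
      (\<forall>f. (\<Sum>v\<in>T. coboundary ?T f v) = 0)" if T: "T \<subseteq> verts F" for T
  proof
    assume orth_null: "\<forall>x\<in>null_space (verts F) (adjacency_matrix ?R). (\<Sum>v\<in>T. x v) = 0"
    have "coboundary ?T f \<in> null_space (verts F) (adjacency_matrix ?R)" for f
      unfolding null_space_eq_coboundaries by blast
    with orth_null show "\<forall>f. (\<Sum>v\<in>T. coboundary ?T f v) = 0" by blast
  next
    assume orth_cob: "\<forall>f. (\<Sum>v\<in>T. coboundary ?T f v) = 0"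
    show "\<forall>x\<in>null_space (verts F) (adjacency_matrix ?R). (\<Sum>v\<in>T. x v) = 0"
    proof
      fix x assume "x \<in> null_space (verts F) (adjacency_matrix ?R)"
      then obtain f where f: "\<forall>v\<in>verts F. x v = coboundary ?T f v"
        unfolding null_space_eq_coboundaries by blast
      have "(\<Sum>v\<in>T. x v) = (\<Sum>v\<in>T. coboundary ?T f v)" using f T by (intro sum.cong) auto
      with orth_cob show "(\<Sum>v\<in>T. x v) = 0" by simp
    qed
  qed
  have "finite (verts ?R)" using C.G by (simp add: verts_relative_interlacement finite_graph_def)
  from dual_adjacency_matroid[OF this]
  have "dual (adjacency_matroid ?R) = \<lparr>ground = verts F, circuits = minimal_sets {T. T \<subseteq> verts F \<and> T \<noteq> {} \<and>
      (\<forall>x\<in>null_space (verts F) (adjacency_matrix ?R). (\<Sum>v\<in>T. x v) = 0)}\<rparr>"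
    by (simp only: verts_relative_interlacement)
  also have "{T. T \<subseteq> verts F \<and> T \<noteq> {} \<and>
      (\<forall>x\<in>null_space (verts F) (adjacency_matrix ?R). (\<Sum>v\<in>T. x v) = 0)} =
      {T. T \<subseteq> edges ?T \<and> T \<noteq> {} \<and> (\<forall>f. (\<Sum>v\<in>T. coboundary ?T f v) = 0)}"
    using orth by (auto simp: touch_graph_def)
  also have "verts F = edges ?T" by (simp add: touch_graph_def)
  finally show ?thesis using polygon_matroid_even_sets[OF finite_touch_graph] by simp
qed

end

theorem theorem10:
  fixes F :: "('v, 'e) graph"
    and P C :: "('v, 'e) circuit set"
  assumes "four_regular F"
    and "circuit_partition F P"
    and "euler_system F C"
    and "compatible F C P"
  shows "dual (adjacency_matroid (relative_interlacement_graph F C P)) =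
    polygon_matroid (touch_graph F P)"
proof -
  have "finite_graph F" using assms(1) by (simp add: four_regular_def)
  moreover have "circuit_partition F C" using assms(3) by (simp add: euler_system_def)
  ultimately interpret compatible_partition F C P
    using assms by unfold_locales
  show ?thesis by (rule dual_adjacency_matroid_eq_polygon_matroid)
qed

end
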